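(* Let $n\ge3$. For $I\subseteq\{1,\ldots,n\}$ let $\xi_I=\sum_{i\in I}H_i$, $I_0=I\cap\{1,\ldots,n-2\}$, and for $i=0,1,2$ let $\varepsilon_I^i=1$ if $|I\cap\{n-1,n\}|=i$ and $\varepsilon^i_I=0$ otherwise. When $n$ is odd, the $I$-canonical elements of $Spin(2n)$ are precisely the elements a) $\xi_I+3\varepsilon_I^1H_s$ and $\xi_I+\varepsilon_I^1(H_s+H_j)$, if $\sum_{i\in I_0}i$ is even; b) $\xi_I+\varepsilon_I^0H_j+\varepsilon_I^1H_s+2\varepsilon_I^2H_s$ and $\xi_I+\varepsilon_I^0H_j+\varepsilon_I^1H_s+\varepsilon_I^2H_j$, if $\sum_{i\in I_0}i$ is odd; where $j\in I_0$ is odd and $s\in I\cap\{n-1,n\}$. When $n$ is even, the $I$-canonical elements of $Spin(2n)$ are precisely the elements a) $\xi_I+\varepsilon_I^1H_s+\varepsilon_I^2H_j$ and $\xi_I+\varepsilon_I^1H_s+\varepsilon_I^2(H_{n-1}+H_n)$, if $\sum_{i\in I_0}i$ is even; b) $\xi_I+\varepsilon_I^0H_j+\varepsilon_I^1(H_s+H_j)$, if $\sum_{i\in I_0}i$ is odd; where $j\in I_0$ is odd and $s\in I\cap\{n-1,n\}$. (Here $j$ and $s$ range over all admissible values; a term with coefficient $\varepsilon_I^i=0$ is simply absent, imposing no requirement that such $j$ or $s$ exist, and an expression in which a $j$ or $s$ occurs with nonzero coefficient but no admissible value exists contributes no element.)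
   Context: General setting. Let $G$ be a compact connected Lie group with Lie algebra $\mathfrak g$, $\mathfrak t\subset\mathfrak g$ a maximal torus (maximal abelian subalgebra), $\alpha_1,\ldots,\alpha_n\in\sqrt{-1}\,\mathfrak t^*$ the positive simple roots for a chosen set of positive roots $\Delta^+$, and $H_1,\ldots,H_n\in\mathfrak t$ the dual basis: $\alpha_i(H_j)=\sqrt{-1}\,\delta_{ij}$. Put $\mathfrak I(G)=\{\xi\in\mathfrak t:\exp_G(2\pi\xi)=e\}$ and $\mathfrak I'(G)=\{\xi\in\mathfrak I(G): \alpha(\xi)/\sqrt{-1}\ge 0 \text{ for all }\alpha\in\Delta^+\}$. For $\xi\in\mathfrak I'(G)$ let $\mathfrak g^\xi_j$ ($j\in\mathbb Z$) be the $\sqrt{-1}\,j$-eigenspace of $\mathrm{ad}\,\xi$ on $\mathfrak g^{\mathbb C}$ and $\mathfrak p_i^\xi=\bigoplus_{j\le i}\mathfrak g_j^\xi$. Define a partial order on $\mathfrak I'(G)$ by: $\xi\preceq\xi'$ iff $\mathfrak p^\xi_i\subseteq\mathfrak p^{\xi'}_i$ for all $i\ge 0$ (writing $\xi=\sum n_iH_i$, $\xi'=\sum n_i'H_i$, this is equivalent to $n_i'\le n_i$ for all $i$). For $I\subseteq\{1,\ldots,n\}$ let $\mathfrak C_I=\{\sum_i n_iH_i : n_i\ge 0,\ n_j=0 \text{ iff } j\notin I\}$. An $I$-canonical element of $G$ is a maximal element of $(\mathfrak I'(G)\cap\mathfrak C_I,\preceq)$. The case $(D_n)$. $\mathfrak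 g=\mathfrak{so}(2n)$, with simply connected group $Spin(2n)$. With respect to a basis $e_1,\ldots,e_{2n}$ of $\mathbb C^{2n}=(\mathbb R^{2n})^{\mathbb C}$ with $e_{n+i}=\overline{e_i}$, $Q(e_i,e_{n+i})=1$ and all other pairings zero ($Q$ the complex-bilinear extension of the standard inner product of $\mathbb R^{2n}$), $E_i$ is the diagonal matrix with $E_ie_i=\sqrt{-1}e_i$, $E_ie_{n+i}=-\sqrt{-1}e_{n+i}$ and zero on the other basis vectors. $\mathfrak t=\{\sum a_iE_i:a_i\in\mathbb R\}$, $L_i(E_j)=\sqrt{-1}\,\delta_{ij}$. The positive roots are $\Delta^+=\{L_i\pm L_j\}_{i<j}$, with simple roots $\alpha_i=L_i-L_{i+1}$ for $1\le i\le n-1$ and $\alpha_n=L_{n-1}+L_n$, so that $H_i=E_1+\ldots+E_i$ for $1\le i\le n-2$, $H_{n-1}=\frac12(E_1+\ldots+E_{n-1}-E_n)$ and $H_n=\frac12(E_1+\ldots+E_{n-1}+E_n)$. *)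

theory Defs
  imports "Jordan_Normal_Form.Matrix" "HOL-Algebra.Group"
begin

section \<open>The Clifford algebra, the group Spin(m) and its exponential map\<close>

text \<open>
  The real Clifford algebra of Euclidean space of dimension \<open>m\<close> with orthonormal basis
  \<open>x_0, ..., x_(m-1)\<close> and the sign convention \<open>v v = - \<langle>v, v\<rangle> 1\<close>.  An element is given by its
  coordinates with respect to the basis of the monomials \<open>x_S = x_(s_1) ... x_(s_k)\<close> for
  \<open>S = {s_1 < ... < s_k}\<close>, a subset of \<open>{..<m}\<close>.  Bringing the product \<open>x_S x_T\<close> into
  increasing order costs one sign for every pair \<open>t < s\<close> with \<open>s\<close> in \<open>S\<close> and \<open>t\<close> in \<open>T\<close>, and
  one more for every common index, because \<open>x_s x_s = -1\<close>.
\<close>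

type_synonym clifford = "nat set \<Rightarrow> real"

definition cl_sign :: "nat set \<Rightarrow> nat set \<Rightarrow> real" where
  "cl_sign S T = (-1) ^ card {(s, t). s \<in> S \<and> t \<in> T \<and> t \<le> s}"

definition cl_mult :: "nat \<Rightarrow> clifford \<Rightarrow> clifford \<Rightarrow> clifford" where
  "cl_mult m a b = (\<lambda>R. \<Sum>S\<in>Pow {..<m}. \<Sum>T\<in>Pow {..<m}.
     if sym_diff S T = R then cl_sign S T * a S * b T else 0)"

definition Cl :: "nat \<Rightarrow> clifford monoid" where
  "Cl m = \<lparr>carrier = {a. \<forall>S. \<not> S \<subseteq> {..<m} \<longrightarrow> a S = 0},
           monoid.mult = cl_mult m,
           one = (\<lambda>S. if S = {} then 1 else 0)\<rparr>"

definition cl_vec :: "nat \<Rightarrow> real vec \<Rightarrow> clifford" where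
  "cl_vec m v = (\<lambda>S. \<Sum>i<m. if S = {i} then v $ i else 0)"

definition unit_vecs :: "nat \<Rightarrow> real vec set" where
  "unit_vecs m = {v \<in> carrier_vec m. v \<bullet> v = 1}"

definition Spin :: "nat \<Rightarrow> clifford monoid" where
  "Spin m = (Cl m)\<lparr>carrier :=
     {foldr (\<lambda>v a. cl_vec m v \<otimes>\<^bsub>Cl m\<^esub> a) vs \<one>\<^bsub>Cl m\<^esub> | vs.
        set vs \<subseteq> unit_vecs m \<and> even (length vs)}\<rparr>"

definition so :: "nat \<Rightarrow> 'a::ring_1 mat set" where
  "so m = {A \<in> carrier_mat m m. A\<^sup>T = - A}"

text \<open>
  The Lie algebra of Spin(m) is the space of bivectors; it is identified with \<open>so(m)\<close> through
  the differential of the covering \<open>Spin(m) \<rightarrow> SO(m)\<close>, that is, the bivector of \<open>A\<close> is the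
  one whose commutator with every vector \<open>v\<close> is \<open>A v\<close>; see \<open>spin_lie_commutator\<close> below.
  Explicitly it is \<open>\<Sum> i<j. A_(j i) / 2 x_i x_j\<close>.
\<close>

definition spin_lie :: "nat \<Rightarrow> real mat \<Rightarrow> clifford" where
  "spin_lie m A = (\<lambda>S. \<Sum>i<m. \<Sum>j<m. if i < j \<and> S = {i, j} then A $$ (j, i) / 2 else 0)"

definition spin_exp :: "nat \<Rightarrow> real mat \<Rightarrow> clifford" where
  "spin_exp m A = (\<lambda>S. \<Sum>k. (spin_lie m A [^]\<^bsub>Cl m\<^esub> (k::nat)) S / fact k)"

section \<open>The torus, roots and canonical elements of type D\<close>

text \<open>
  All matrices act on Euclidean space of dimension \<open>2 n\<close> with its standard orthonormal basis
  \<open>x_1, ..., x_2n\<close> (row and column \<open>k - 1\<close> belong to \<open>x_k\<close>).  The isotropic basis is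
  \<open>e_i = (x_i - \<i> x_(n+i)) / sqrt 2\<close>, \<open>e_(n+i) = (x_i + \<i> x_(n+i)) / sqrt 2\<close>.  The element
  \<open>E_i\<close> is diagonal in that basis, see \<open>E_mult_e_vec\<close>, and in the basis \<open>x\<close> it is the
  infinitesimal rotation \<open>x_i \<mapsto> x_(n+i)\<close>, \<open>x_(n+i) \<mapsto> - x_i\<close>.
\<close>

definition e_vec :: "nat \<Rightarrow> nat \<Rightarrow> complex vec" where
  "e_vec n k = vec (2 * n) (\<lambda>r.
     if k \<le> n then (if r = k - 1 then 1 else if r = n + k - 1 then - \<i> else 0) / sqrt 2
     else (if r = k - n - 1 then 1 else if r = k - 1 then \<i> else 0) / sqrt 2)"

definition E :: "nat \<Rightarrow> nat \<Rightarrow> real mat" where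
  "E n i = mat (2 * n) (2 * n) (\<lambda>(r, c).
     if r = n + i - 1 \<and> c = i - 1 then 1
     else if r = i - 1 \<and> c = n + i - 1 then - 1 else 0)"

definition sum_matrices :: "nat \<Rightarrow> ('i \<Rightarrow> 'a::comm_monoid_add mat) \<Rightarrow> 'i set \<Rightarrow> 'a mat" where
  "sum_matrices m F J = mat m m (\<lambda>(r, c). \<Sum>i\<in>J. F i $$ (r, c))"

definition torus_alg :: "nat \<Rightarrow> real mat set" where
  "torus_alg n = {sum_matrices (2 * n) (\<lambda>i. a i \<cdot>\<^sub>m E n i) {1..n} | a. True}"

definition L :: "nat \<Rightarrow> nat \<Rightarrow> real mat \<Rightarrow> complex" where
  "L n i \<xi> = \<i> * complex_of_real (\<xi> $$ (n + i - 1, i - 1))"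

definition pos_roots :: "nat \<Rightarrow> (real mat \<Rightarrow> complex) set" where
  "pos_roots n = {\<lambda>\<xi>. L n i \<xi> + L n j \<xi> | i j. 1 \<le> i \<and> i < j \<and> j \<le> n}
               \<union> {\<lambda>\<xi>. L n i \<xi> - L n j \<xi> | i j. 1 \<le> i \<and> i < j \<and> j \<le> n}"

definition simple_root :: "nat \<Rightarrow> nat \<Rightarrow> real mat \<Rightarrow> complex" where
  "simple_root n i \<xi> = (if i < n then L n i \<xi> - L n (i + 1) \<xi> else L n (n - 1) \<xi> + L n n \<xi>)"

definition H :: "nat \<Rightarrow> nat \<Rightarrow> real mat" where
  "H n i = (if i \<le> n - 2 then sum_matrices (2 * n) (E n) {1..i}
            else if i = n - 1 then (1/2) \<cdot>\<^sub>m (sum_matrices (2 * n) (E n) {1..n-1} - E n n)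
            else (1/2) \<cdot>\<^sub>m (sum_matrices (2 * n) (E n) {1..n-1} + E n n))"

text \<open>The sets \<open>\<II>(G)\<close> and \<open>\<II>'(G)\<close> for \<open>G = Spin(2n)\<close>.\<close>

definition integral_lattice :: "nat \<Rightarrow> real mat set" where
  "integral_lattice n =
     {\<xi> \<in> torus_alg n. spin_exp (2 * n) ((2 * pi) \<cdot>\<^sub>m \<xi>) = \<one>\<^bsub>Spin (2 * n)\<^esub>}"

definition dominant_lattice :: "nat \<Rightarrow> real mat set" where
  "dominant_lattice n = {\<xi> \<in> integral_lattice n. \<forall>\<alpha>\<in>pos_roots n. \<alpha> \<xi> / \<i> \<ge> 0}"

definition ad :: "real mat \<Rightarrow> complex mat \<Rightarrow> complex mat" where
  "ad \<xi> X = map_mat complex_of_real \<xi> * X - X * map_mat complex_of_real \<xi>"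

definition g_eigenspace :: "nat \<Rightarrow> real mat \<Rightarrow> int \<Rightarrow> complex mat set" where
  "g_eigenspace n \<xi> j = {X \<in> so (2 * n). ad \<xi> X = (\<i> * of_int j) \<cdot>\<^sub>m X}"

definition p_filtration :: "nat \<Rightarrow> real mat \<Rightarrow> int \<Rightarrow> complex mat set" where
  "p_filtration n \<xi> i = {sum_matrices (2 * n) X J | X J.
     finite J \<and> J \<subseteq> {..i} \<and> (\<forall>j\<in>J. X j \<in> g_eigenspace n \<xi> j)}"

definition canonical_le :: "nat \<Rightarrow> real mat \<Rightarrow> real mat \<Rightarrow> bool" where
  "canonical_le n \<xi> \<xi>' \<longleftrightarrow> (\<forall>i\<ge>0. p_filtration n \<xi> i \<subseteq> p_filtration n \<xi>' i)"

definition cone :: "nat \<Rightarrow> nat set \<Rightarrow> real mat set" where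
  "cone n I = {sum_matrices (2 * n) (\<lambda>i. c i \<cdot>\<^sub>m H n i) {1..n} | c :: nat \<Rightarrow> real.
     (\<forall>i\<in>{1..n}. c i \<ge> 0 \<and> (c i = 0 \<longleftrightarrow> i \<notin> I))}"

definition canonical_elements :: "nat \<Rightarrow> nat set \<Rightarrow> real mat set" where
  "canonical_elements n I = {\<xi> \<in> dominant_lattice n \<inter> cone n I.
     \<forall>\<xi>' \<in> dominant_lattice n \<inter> cone n I. canonical_le n \<xi> \<xi>' \<longrightarrow> \<xi>' = \<xi>}"

definition xi :: "nat \<Rightarrow> nat set \<Rightarrow> real mat" where
  "xi n I = sum_matrices (2 * n) (H n) I"

definition I0 :: "nat \<Rightarrow> nat set \<Rightarrow> nat set" where
  "I0 n I = I \<inter> {1..n - 2}"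

definition eps :: "nat \<Rightarrow> nat set \<Rightarrow> nat \<Rightarrow> real" where
  "eps n I k = (if card (I \<inter> {n - 1, n}) = k then 1 else 0)"

section \<open>The definitions agree with their intended meaning\<close>

lemma prod_sym_diff:
  fixes f :: "'i \<Rightarrow> real"
  assumes "finite S" "finite T" and sq: "\<And>x. f x * f x = 1"
  shows "prod f (sym_diff S T) = prod f S * prod f T"
proof -
  have "prod f S = prod f (S - T) * prod f (S \<inter> T)" if "finite S" for S T :: "'i set"
    using prod.Int_Diff[OF that, of f T] by simp
  moreover have "prod f (S \<inter> T) * prod f (S \<inter> T) = 1"
    by (simp add: prod.distrib[symmetric] sq)
  moreover have "prod f (sym_diff S T) = prod f (S - T) * prod f (T - S)"
    using assms by (intro prod.union_disjoint) auto
  ultimately show ?thesis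
    using assms(1,2) by (metis (no_types, lifting) Int_commute mult.assoc mult.commute mult.right_neutral)
qed

lemma cl_sign_eq_prod:
  assumes "finite S" "finite T"
  shows "cl_sign S T = (\<Prod>s\<in>S. \<Prod>t\<in>T. if t \<le> s then -1 else 1)"
proof -
  have "(\<Prod>s\<in>S. \<Prod>t\<in>T. if t \<le> s then -1 else (1::real))
      = (\<Prod>p\<in>S \<times> T. if snd p \<le> fst p then -1 else 1)"
    by (simp add: prod.cartesian_product case_prod_unfold)
  also have "\<dots> = (\<Prod>p\<in>{p \<in> S \<times> T. snd p \<le> fst p}. -1)"
    using assms by (intro prod.inter_filter[symmetric]) auto
  also have "\<dots> = (-1) ^ card {p \<in> S \<times> T. snd p \<le> fst p}" by simp
  also have "{p \<in> S \<times> T. snd p \<le> fst p} = {(s, t). s \<in> S \<and> t \<in> T \<and> t \<le> s}" by auto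
  finally show ?thesis by (simp add: cl_sign_def)
qed

lemma cl_sign_sym_diff_left:
  assumes "finite S" "finite S'" "finite T"
  shows "cl_sign (sym_diff S S') T = cl_sign S T * cl_sign S' T"
proof -
  have "(\<Prod>t\<in>T. if t \<le> s then -1 else (1::real)) * (\<Prod>t\<in>T. if t \<le> s then -1 else 1) = 1" for s :: nat
    unfolding prod.distrib[symmetric] by (intro prod.neutral) auto
  then show ?thesis
    using assms by (simp add: cl_sign_eq_prod prod_sym_diff)
qed

lemma cl_sign_sym_diff_right:
  assumes "finite S" "finite T" "finite T'"
  shows "cl_sign S (sym_diff T T') = cl_sign S T * cl_sign S T'"
proof -
  have "(\<Prod>t\<in>sym_diff T T'. if t \<le> s then -1 else (1::real))
     = (\<Prod>t\<in>T. if t \<le> s then -1 else 1) * (\<Prod>t\<in>T'. if t \<le> s then -1 else 1)" for s :: nat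
    using assms by (intro prod_sym_diff) auto
  then show ?thesis
    using assms by (simp add: cl_sign_eq_prod prod.distrib)
qed

lemma cl_sign_empty [simp]: "cl_sign {} T = 1" "cl_sign S {} = 1"
  by (simp_all add: cl_sign_def)

lemma cl_mult_left: "cl_mult m a b R =
  (\<Sum>S\<in>Pow {..<m}. (\<Sum>T\<in>Pow {..<m}. if sym_diff S T = R then cl_sign S T * b T else 0) * a S)"
  unfolding cl_mult_def sum_distrib_right by (intro sum.cong refl) auto

lemma cl_mult_right: "cl_mult m a b R =
  (\<Sum>T\<in>Pow {..<m}. (\<Sum>S\<in>Pow {..<m}. if sym_diff S T = R then cl_sign S T * a S else 0) * b T)"
  unfolding cl_mult_def sum_distrib_right by (subst sum.swap) (intro sum.cong refl, auto)

lemma sum_cl_mult: "(\<Sum>W\<in>Pow {..<m}. F W * cl_mult m a b W) =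
  (\<Sum>S\<in>Pow {..<m}. \<Sum>T\<in>Pow {..<m}. F (sym_diff S T) * (cl_sign S T * a S * b T))"
proof -
  have "(\<Sum>W\<in>Pow {..<m}. F W * cl_mult m a b W) =
    (\<Sum>W\<in>Pow {..<m}. \<Sum>S\<in>Pow {..<m}. \<Sum>T\<in>Pow {..<m}.
       if sym_diff S T = W then F W * (cl_sign S T * a S * b T) else 0)"
    unfolding cl_mult_def sum_distrib_left by (intro sum.cong refl) auto
  also have "\<dots> = (\<Sum>S\<in>Pow {..<m}. \<Sum>W\<in>Pow {..<m}. \<Sum>T\<in>Pow {..<m}.
       if sym_diff S T = W then F W * (cl_sign S T * a S * b T) else 0)"
    by (rule sum.swap)
  also have "\<dots> = (\<Sum>S\<in>Pow {..<m}. \<Sum>T\<in>Pow {..<m}. \<Sum>W\<in>Pow {..<m}.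
       if sym_diff S T = W then F W * (cl_sign S T * a S * b T) else 0)"
    by (intro sum.cong refl sum.swap)
  also have "\<dots> = (\<Sum>S\<in>Pow {..<m}. \<Sum>T\<in>Pow {..<m}. F (sym_diff S T) * (cl_sign S T * a S * b T))"
  proof (intro sum.cong refl)
    fix S T assume "S \<in> Pow {..<m}" "T \<in> Pow {..<m}"
    then have "sym_diff S T \<in> Pow {..<m}" by auto
    then show "(\<Sum>W\<in>Pow {..<m}. if sym_diff S T = W then F W * (cl_sign S T * a S * b T) else 0)
       = F (sym_diff S T) * (cl_sign S T * a S * b T)"
      by (subst sum.delta') auto
  qed
  finally show ?thesis .
qed

lemma cl_mult_assoc: "cl_mult m (cl_mult m a b) c = cl_mult m a (cl_mult m b c)"
proof
  fix R
  have fin: "finite S" if "S \<in> Pow {..<m}" for S :: "nat set"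
    using that finite_subset by auto
  have "cl_mult m (cl_mult m a b) c R = (\<Sum>S\<in>Pow {..<m}. \<Sum>T\<in>Pow {..<m}. \<Sum>U\<in>Pow {..<m}.
      if sym_diff (sym_diff S T) U = R then cl_sign (sym_diff S T) U * cl_sign S T * a S * b T * c U else 0)"
    unfolding cl_mult_left[of m "cl_mult m a b"] sum_cl_mult
    unfolding sum_distrib_right
    by (intro sum.cong refl) auto
  also have "\<dots> = (\<Sum>S\<in>Pow {..<m}. \<Sum>T\<in>Pow {..<m}. \<Sum>U\<in>Pow {..<m}.
      if sym_diff S (sym_diff T U) = R then cl_sign S (sym_diff T U) * cl_sign T U * a S * b T * c U else 0)"
  proof (intro sum.cong refl)
    fix S T U assume *: "S \<in> Pow {..<m}" "T \<in> Pow {..<m}" "U \<in> Pow {..<m}"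
    have "sym_diff (sym_diff S T) U = sym_diff S (sym_diff T U)" by auto
    then show "(if sym_diff (sym_diff S T) U = R
        then cl_sign (sym_diff S T) U * cl_sign S T * a S * b T * c U else 0) =
       (if sym_diff S (sym_diff T U) = R
        then cl_sign S (sym_diff T U) * cl_sign T U * a S * b T * c U else 0)"
      unfolding cl_sign_sym_diff_left[OF *[THEN fin]] cl_sign_sym_diff_right[OF *[THEN fin]]
      by simp
  qed
  also have "\<dots> = (\<Sum>T\<in>Pow {..<m}. \<Sum>U\<in>Pow {..<m}. \<Sum>S\<in>Pow {..<m}.
      if sym_diff S (sym_diff T U) = R then cl_sign S (sym_diff T U) * cl_sign T U * a S * b T * c U else 0)"
    by (subst sum.swap) (intro sum.cong refl sum.swap)
  also have "\<dots> = cl_mult m a (cl_mult m b c) R"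
    unfolding cl_mult_right[of m a "cl_mult m b c"] sum_cl_mult
    unfolding sum_distrib_right
    by (intro sum.cong refl) auto
  finally show "cl_mult m (cl_mult m a b) c R = cl_mult m a (cl_mult m b c) R" .
qed

lemma monoid_Cl: "monoid (Cl m)"
proof (rule monoidI)
  have closed: "cl_mult m a b R = 0" if "\<not> R \<subseteq> {..<m}" for a b R
    unfolding cl_mult_def using that by (intro sum.neutral ballI) auto
  then show "x \<otimes>\<^bsub>Cl m\<^esub> y \<in> carrier (Cl m)" for x y
    by (auto simp: Cl_def)
  fix x assume x: "x \<in> carrier (Cl m)"
  have *: "x R = 0" if "\<not> R \<subseteq> {..<m}" for R using x that by (auto simp: Cl_def)
  have "cl_mult m \<one>\<^bsub>Cl m\<^esub> x R = (if R \<in> Pow {..<m} then x R else 0)" for R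
  proof -
    have "cl_mult m \<one>\<^bsub>Cl m\<^esub> x R = (\<Sum>S\<in>Pow {..<m}. if S = {} then \<Sum>T\<in>Pow {..<m}. if T = R then x T else 0 else 0)"
      unfolding cl_mult_def
    proof (intro sum.cong refl)
      fix S
      show "(\<Sum>T\<in>Pow {..<m}. if sym_diff S T = R then cl_sign S T * \<one>\<^bsub>Cl m\<^esub> S * x T else 0)
          = (if S = {} then \<Sum>T\<in>Pow {..<m}. if T = R then x T else 0 else 0)"
        by (cases "S = {}") (simp_all add: Cl_def cong: if_cong)
    qed
    then show ?thesis by (simp add: sum.delta)
  qed
  then show "\<one>\<^bsub>Cl m\<^esub> \<otimes>\<^bsub>Cl m\<^esub> x = x"
    using * by (auto simp: Cl_def fun_eq_iff)
  have "cl_mult m x \<one>\<^bsub>Cl m\<^esub> R = (if R \<in> Pow {..<m} then x R else 0)" for R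
  proof -
    have "cl_mult m x \<one>\<^bsub>Cl m\<^esub> R = (\<Sum>S\<in>Pow {..<m}. \<Sum>T\<in>Pow {..<m}. if T = {} then if S = R then x S else 0 else 0)"
      unfolding cl_mult_def by (intro sum.cong refl) (auto simp: Cl_def)
    then show ?thesis by (simp add: sum.delta)
  qed
  then show "x \<otimes>\<^bsub>Cl m\<^esub> \<one>\<^bsub>Cl m\<^esub> = x"
    using * by (auto simp: Cl_def fun_eq_iff)
qed (auto simp: Cl_def cl_mult_assoc)

lemma sum_cl_vec: "(\<Sum>S\<in>Pow {..<m}. F S * cl_vec m v S) = (\<Sum>i<m. F {i} * v $ i)"
proof -
  have "(\<Sum>S\<in>Pow {..<m}. F S * cl_vec m v S)
      = (\<Sum>i<m. \<Sum>S\<in>Pow {..<m}. if S = {i} then F S * v $ i else 0)"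
    unfolding cl_vec_def sum_distrib_left by (subst sum.swap) (intro sum.cong refl, auto)
  also have "\<dots> = (\<Sum>i<m. F {i} * v $ i)"
    by (intro sum.cong refl) (auto simp: sum.delta)
  finally show ?thesis .
qed

lemma cl_sign_single: "cl_sign {i} {j} = (if j \<le> i then -1 else 1)"
  by (simp add: cl_sign_eq_prod)

lemma cl_vec_square:
  assumes "v \<in> carrier_vec m"
  shows "cl_mult m (cl_vec m v) (cl_vec m v) = (\<lambda>S. - (v \<bullet> v) * \<one>\<^bsub>Cl m\<^esub> S)"
proof
  fix R
  define G where "G i j = (if sym_diff {i} {j} = R then cl_sign {i} {j} * v $ j * v $ i else 0)" for i j
  have 1: "cl_mult m (cl_vec m v) (cl_vec m v) R = (\<Sum>i<m. \<Sum>j<m. G i j)"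
  proof -
    have "(\<Sum>T\<in>Pow {..<m}. if sym_diff S T = R then cl_sign S T * cl_vec m v T else 0)
        = (\<Sum>j<m. (if sym_diff S {j} = R then cl_sign S {j} else 0) * v $ j)" for S
    proof -
      have "(\<Sum>T\<in>Pow {..<m}. if sym_diff S T = R then cl_sign S T * cl_vec m v T else 0)
          = (\<Sum>T\<in>Pow {..<m}. (if sym_diff S T = R then cl_sign S T else 0) * cl_vec m v T)"
        by (intro sum.cong refl) auto
      then show ?thesis by (simp only: sum_cl_vec)
    qed
    then have "cl_mult m (cl_vec m v) (cl_vec m v) R
       = (\<Sum>i<m. (\<Sum>j<m. (if sym_diff {i} {j} = R then cl_sign {i} {j} else 0) * v $ j) * v $ i)"
      unfolding cl_mult_left by (simp only: sum_cl_vec)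
    also have "\<dots> = (\<Sum>i<m. \<Sum>j<m. G i j)"
      unfolding sum_distrib_right G_def by (intro sum.cong refl) auto
    finally show ?thesis .
  qed
  have "2 * (\<Sum>i<m. \<Sum>j<m. G i j) = (\<Sum>i<m. \<Sum>j<m. G i j + G j i)"
    using sum.swap[of G "{..<m}" "{..<m}"] by (simp add: sum.distrib)
  also have "\<dots> = (\<Sum>i<m. \<Sum>j<m. if j = i then (if R = {} then -2 * (v $ i * v $ i) else 0) else 0)"
    by (intro sum.cong refl) (auto simp: G_def cl_sign_single)
  also have "\<dots> = -2 * (if R = {} then v \<bullet> v else 0)"
    using assms by (simp add: sum.delta scalar_prod_def sum_distrib_left atLeast0LessThan sum_negf)
  finally show "cl_mult m (cl_vec m v) (cl_vec m v) R = - (v \<bullet> v) * \<one>\<^bsub>Cl m\<^esub> R"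
    unfolding 1 by (auto simp: Cl_def)
qed

lemma cl_vec_carrier: "cl_vec m v \<in> carrier (Cl m)"
  unfolding Cl_def cl_vec_def by (auto intro!: sum.neutral)

lemma cl_mult_scale:
  "cl_mult m (\<lambda>S. c * a S) b = (\<lambda>S. c * cl_mult m a b S)"
  "cl_mult m a (\<lambda>S. c * b S) = (\<lambda>S. c * cl_mult m a b S)"
  unfolding cl_mult_def sum_distrib_left by (intro ext sum.cong refl; simp)+

lemma group_Spin: "group (Spin m)"
proof -
  interpret monoid "Cl m" by (rule monoid_Cl)
  define pr where "pr vs = foldr (\<lambda>v a. cl_vec m v \<otimes>\<^bsub>Cl m\<^esub> a) vs \<one>\<^bsub>Cl m\<^esub>" for vs
  have Spin: "carrier (Spin m) = {pr vs | vs. set vs \<subseteq> unit_vecs m \<and> even (length vs)}"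
    "mult (Spin m) = mult (Cl m)" "one (Spin m) = one (Cl m)"
    by (simp_all add: Spin_def pr_def)
  have [simp]: "pr [] = \<one>\<^bsub>Cl m\<^esub>" "pr (v # vs) = cl_vec m v \<otimes>\<^bsub>Cl m\<^esub> pr vs" for v vs
    by (simp_all add: pr_def)
  have cl [simp, intro]: "pr vs \<in> carrier (Cl m)" for vs
    by (induction vs) (auto intro: cl_vec_carrier)
  have app: "pr (us @ vs) = pr us \<otimes>\<^bsub>Cl m\<^esub> pr vs" for us vs
    by (induction us) (auto simp: m_assoc cl_vec_carrier)
  have inv: "pr (rev vs) \<otimes>\<^bsub>Cl m\<^esub> pr vs = (\<lambda>S. (-1) ^ length vs * \<one>\<^bsub>Cl m\<^esub> S)"
    if "set vs \<subseteq> unit_vecs m" for vs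
    using that
  proof (induction vs)
    case (Cons v vs)
    then have v: "v \<in> carrier_vec m" "v \<bullet> v = 1" by (auto simp: unit_vecs_def)
    have mult: "x \<otimes>\<^bsub>Cl m\<^esub> y = cl_mult m x y" for x y by (simp add: Cl_def)
    have "pr (rev (v # vs)) \<otimes>\<^bsub>Cl m\<^esub> pr (v # vs)
       = pr (rev vs) \<otimes>\<^bsub>Cl m\<^esub> ((cl_vec m v \<otimes>\<^bsub>Cl m\<^esub> cl_vec m v) \<otimes>\<^bsub>Cl m\<^esub> pr vs)"
      by (simp add: app m_assoc cl_vec_carrier)
    also have "(cl_vec m v \<otimes>\<^bsub>Cl m\<^esub> cl_vec m v) \<otimes>\<^bsub>Cl m\<^esub> pr vs = (\<lambda>S. (-1) * (\<one>\<^bsub>Cl m\<^esub> \<otimes>\<^bsub>Cl m\<^esub> pr vs) S)"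
      using cl_vec_square[OF v(1)] by (simp only: mult v(2) cl_mult_scale)
    also have "\<dots> = (\<lambda>S. (-1) * pr vs S)" by simp
    also have "pr (rev vs) \<otimes>\<^bsub>Cl m\<^esub> (\<lambda>S. (-1) * pr vs S) = (\<lambda>S. (-1) * (pr (rev vs) \<otimes>\<^bsub>Cl m\<^esub> pr vs) S)"
      by (simp only: mult cl_mult_scale)
    also have "\<dots> = (\<lambda>S. (-1) ^ length (v # vs) * \<one>\<^bsub>Cl m\<^esub> S)"
      using Cons by simp
    finally show ?case .
  qed simp
  show ?thesis
  proof (rule groupI, unfold Spin(2,3))
    show "x \<otimes>\<^bsub>Cl m\<^esub> y \<in> carrier (Spin m)" if xy: "x \<in> carrier (Spin m)" "y \<in> carrier (Spin m)" for x y
    proof -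
      obtain us vs where *: "x = pr us" "y = pr vs" "set us \<subseteq> unit_vecs m" "even (length us)"
        "set vs \<subseteq> unit_vecs m" "even (length vs)"
        using xy unfolding Spin by blast
      have "x \<otimes>\<^bsub>Cl m\<^esub> y = pr (us @ vs)" "set (us @ vs) \<subseteq> unit_vecs m" "even (length (us @ vs))"
        using * app by auto
      then show ?thesis unfolding Spin by blast
    qed
    have "\<one>\<^bsub>Cl m\<^esub> = pr []" "set [] \<subseteq> unit_vecs m" "even (length ([] :: real vec list))" by auto
    then show "\<one>\<^bsub>Cl m\<^esub> \<in> carrier (Spin m)" unfolding Spin by blast
    have sub: "x \<in> carrier (Cl m)" if "x \<in> carrier (Spin m)" for x
      using that unfolding Spin by auto
    show "x \<otimes>\<^bsub>Cl m\<^esub> y \<otimes>\<^bsub>Cl m\<^esub> z = x \<otimes>\<^bsub>Cl m\<^esub> (y \<otimes>\<^bsub>Cl m\<^esub> z)"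
      if "x \<in> carrier (Spin m)" "y \<in> carrier (Spin m)" "z \<in> carrier (Spin m)" for x y z
      using that[THEN sub] by (rule m_assoc)
    show "\<one>\<^bsub>Cl m\<^esub> \<otimes>\<^bsub>Cl m\<^esub> x = x" if "x \<in> carrier (Spin m)" for x
      using sub[OF that] by simp
    show "\<exists>y\<in>carrier (Spin m). y \<otimes>\<^bsub>Cl m\<^esub> x = \<one>\<^bsub>Cl m\<^esub>" if x: "x \<in> carrier (Spin m)" for x
    proof -
      obtain vs where *: "x = pr vs" "set vs \<subseteq> unit_vecs m" "even (length vs)"
        using x unfolding Spin by blast
      then have "pr (rev vs) \<in> carrier (Spin m)" unfolding Spin by (auto intro!: exI[of _ "rev vs"])
      moreover have "pr (rev vs) \<otimes>\<^bsub>Cl m\<^esub> x = \<one>\<^bsub>Cl m\<^esub>" using inv[OF *(2)] * by simp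
      ultimately show ?thesis by blast
    qed
  qed
qed

lemma sum_spin_lie: "(\<Sum>S\<in>Pow {..<m}. F S * spin_lie m A S)
  = (\<Sum>i<m. \<Sum>j<m. if i < j then F {i, j} * (A $$ (j, i) / 2) else 0)"
proof -
  have "(\<Sum>S\<in>Pow {..<m}. F S * spin_lie m A S) = (\<Sum>S\<in>Pow {..<m}. \<Sum>i<m. \<Sum>j<m.
     if S = {i, j} then if i < j then F {i, j} * (A $$ (j, i) / 2) else 0 else 0)"
    unfolding spin_lie_def sum_distrib_left by (intro sum.cong refl) auto
  also have "\<dots> = (\<Sum>i<m. \<Sum>S\<in>Pow {..<m}. \<Sum>j<m.
     if S = {i, j} then if i < j then F {i, j} * (A $$ (j, i) / 2) else 0 else 0)"
    by (rule sum.swap)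
  also have "\<dots> = (\<Sum>i<m. \<Sum>j<m. \<Sum>S\<in>Pow {..<m}.
     if S = {i, j} then if i < j then F {i, j} * (A $$ (j, i) / 2) else 0 else 0)"
    by (intro sum.cong refl sum.swap)
  also have "\<dots> = (\<Sum>i<m. \<Sum>j<m. if i < j then F {i, j} * (A $$ (j, i) / 2) else 0)"
    by (intro sum.cong refl) (auto simp: sum.delta)
  finally show ?thesis .
qed

lemma spin_lie_commutator:
  assumes A: "A \<in> so m" and v: "v \<in> carrier_vec m"
  shows "cl_mult m (spin_lie m A) (cl_vec m v) S - cl_mult m (cl_vec m v) (spin_lie m A) S
       = cl_vec m (A *\<^sub>v v) S"
proof -
  have Ac: "A \<in> carrier_mat m m" and At: "A\<^sup>T = - A" using A by (auto simp: so_def)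
  have skew: "A $$ (i, j) = - A $$ (j, i)" if "i < m" "j < m" for i j
  proof -
    have "A\<^sup>T $$ (j, i) = (- A) $$ (j, i)" using At by simp
    then show ?thesis using that Ac by simp
  qed
  define X where "X i j k = (if i < j then (if sym_diff {i, j} {k} = S then cl_sign {i, j} {k} else 0)
      * v $ k * (A $$ (j, i) / 2) else 0)" for i j k
  define Y where "Y i j k = (if i < j then (if sym_diff {k} {i, j} = S then cl_sign {k} {i, j} else 0)
      * v $ k * (A $$ (j, i) / 2) else 0)" for i j k
  define T where "T i j = (if S = {j} then A $$ (j, i) * v $ i else 0)" for i j
  have 1: "cl_mult m (spin_lie m A) (cl_vec m v) S = (\<Sum>i<m. \<Sum>j<m. \<Sum>k<m. X i j k)"
  proof -
    have "(\<Sum>V\<in>Pow {..<m}. if sym_diff W V = S then cl_sign W V * cl_vec m v V else 0)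
        = (\<Sum>k<m. (if sym_diff W {k} = S then cl_sign W {k} else 0) * v $ k)" for W
    proof -
      have "(\<Sum>V\<in>Pow {..<m}. if sym_diff W V = S then cl_sign W V * cl_vec m v V else 0) = (\<Sum>V\<in>Pow {..<m}. (if sym_diff W V = S then cl_sign W V else 0) * cl_vec m v V)"
        by (intro sum.cong refl) auto
      then show ?thesis by (simp only: sum_cl_vec)
    qed
    then have "cl_mult m (spin_lie m A) (cl_vec m v) S = (\<Sum>i<m. \<Sum>j<m. if i < j then
        (\<Sum>k<m. (if sym_diff {i,j} {k} = S then cl_sign {i,j} {k} else 0) * v $ k) * (A $$ (j, i) / 2) else 0)"
      unfolding cl_mult_left by (simp only: sum_spin_lie)
    also have "\<dots> = (\<Sum>i<m. \<Sum>j<m. \<Sum>k<m. X i j k)"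
      by (intro sum.cong refl) (simp add: X_def sum_distrib_right)
    finally show ?thesis .
  qed
  have 2: "cl_mult m (cl_vec m v) (spin_lie m A) S = (\<Sum>i<m. \<Sum>j<m. \<Sum>k<m. Y i j k)"
  proof -
    have "(\<Sum>V\<in>Pow {..<m}. if sym_diff V W = S then cl_sign V W * cl_vec m v V else 0)
        = (\<Sum>k<m. (if sym_diff {k} W = S then cl_sign {k} W else 0) * v $ k)" for W
    proof -
      have "(\<Sum>V\<in>Pow {..<m}. if sym_diff V W = S then cl_sign V W * cl_vec m v V else 0) = (\<Sum>V\<in>Pow {..<m}. (if sym_diff V W = S then cl_sign V W else 0) * cl_vec m v V)"
        by (intro sum.cong refl) auto
      then show ?thesis by (simp only: sum_cl_vec)
    qed
    then have "cl_mult m (cl_vec m v) (spin_lie m A) S = (\<Sum>i<m. \<Sum>j<m. if i < j then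
        (\<Sum>k<m. (if sym_diff {k} {i,j} = S then cl_sign {k} {i,j} else 0) * v $ k) * (A $$ (j, i) / 2) else 0)"
      unfolding cl_mult_right by (simp only: sum_spin_lie)
    also have "\<dots> = (\<Sum>i<m. \<Sum>j<m. \<Sum>k<m. Y i j k)"
      by (intro sum.cong refl) (simp add: Y_def sum_distrib_right)
    finally show ?thesis .
  qed
  have 3: "(\<Sum>k<m. X i j k - Y i j k) = (if i < j then T i j + T j i else 0)" if "i < m" "j < m" for i j
  proof (cases "i < j")
    case True
    have sg: "cl_sign {i, j} {k} = (if k \<le> i then -1 else 1) * (if k \<le> j then -1 else 1)"
      "cl_sign {k} {i, j} = (if i \<le> k then -1 else 1) * (if j \<le> k then -1 else 1)" for k
      using True by (simp_all add: cl_sign_eq_prod)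
    have sd: "sym_diff {i, j} {i} = {j}" "sym_diff {i, j} {j} = {i}"
      and sd': "sym_diff {k} {i, j} = sym_diff {i, j} {k}" for k using True by auto
    have "X i j k - Y i j k = (if k = i then T i j else 0) + (if k = j then T j i else 0)" for k
    proof (cases "k = i \<or> k = j")
      case True
      then show ?thesis
        using \<open>i < j\<close> skew[OF that] sd unfolding X_def Y_def T_def sg sd' by auto
    next
      case False
      then show ?thesis unfolding X_def Y_def sg sd' by auto
    qed
    then show ?thesis using True that by (simp add: sum.distrib)
  qed (simp add: X_def Y_def)
  have 4: "(\<Sum>i<m. \<Sum>j<m. if i < j then T j i else 0) = (\<Sum>i<m. \<Sum>j<m. if j < i then T i j else 0)"
    by (rule sum.swap)
  have "cl_mult m (spin_lie m A) (cl_vec m v) S - cl_mult m (cl_vec m v) (spin_lie m A) S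
      = (\<Sum>i<m. \<Sum>j<m. if i < j then T i j + T j i else 0)"
    unfolding 1 2 sum_subtractf[symmetric] using 3 by (intro sum.cong refl) auto
  also have "\<dots> = (\<Sum>i<m. \<Sum>j<m. if i < j then T i j else 0) + (\<Sum>i<m. \<Sum>j<m. if i < j then T j i else 0)"
    unfolding sum.distrib[symmetric] by (intro sum.cong refl) simp
  also have "\<dots> = (\<Sum>i<m. \<Sum>j<m. T i j)"
  proof -
    have "(if i < j then T i j else 0) + (if j < i then T i j else 0) = T i j" if "i < m" "j < m" for i j
      using skew[of i i] that by (cases i j rule: linorder_cases) (auto simp: T_def)
    then show ?thesis
      unfolding 4 sum.distrib[symmetric] by (intro sum.cong refl) simp
  qed
  also have "\<dots> = (\<Sum>j<m. \<Sum>i<m. T i j)" by (rule sum.swap)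
  also have "\<dots> = cl_vec m (A *\<^sub>v v) S"
    unfolding cl_vec_def using Ac v
    by (intro sum.cong refl) (auto simp: T_def scalar_prod_def atLeast0LessThan)
  finally show ?thesis .
qed

lemma cl_norm_mult:
  "(\<Sum>R\<in>Pow {..<m}. \<bar>cl_mult m a b R\<bar>) \<le> (\<Sum>S\<in>Pow {..<m}. \<bar>a S\<bar>) * (\<Sum>T\<in>Pow {..<m}. \<bar>b T\<bar>)"
proof -
  have "\<bar>cl_mult m a b R\<bar> \<le> (\<Sum>S\<in>Pow {..<m}. \<Sum>T\<in>Pow {..<m}. if sym_diff S T = R then \<bar>a S\<bar> * \<bar>b T\<bar> else 0)" for R
    unfolding cl_mult_def
    by (intro order.trans[OF sum_abs] sum_mono) (auto simp: cl_sign_def abs_mult power_abs)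
  then have "(\<Sum>R\<in>Pow {..<m}. \<bar>cl_mult m a b R\<bar>) \<le>
     (\<Sum>R\<in>Pow {..<m}. \<Sum>S\<in>Pow {..<m}. \<Sum>T\<in>Pow {..<m}. if sym_diff S T = R then \<bar>a S\<bar> * \<bar>b T\<bar> else 0)"
    by (intro sum_mono) auto
  also have "\<dots> = (\<Sum>S\<in>Pow {..<m}. \<Sum>R\<in>Pow {..<m}. \<Sum>T\<in>Pow {..<m}. if sym_diff S T = R then \<bar>a S\<bar> * \<bar>b T\<bar> else 0)"
    by (rule sum.swap)
  also have "\<dots> = (\<Sum>S\<in>Pow {..<m}. \<Sum>T\<in>Pow {..<m}. \<Sum>R\<in>Pow {..<m}. if sym_diff S T = R then \<bar>a S\<bar> * \<bar>b T\<bar> else 0)"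
    by (intro sum.cong refl sum.swap)
  also have "\<dots> = (\<Sum>S\<in>Pow {..<m}. \<Sum>T\<in>Pow {..<m}. \<bar>a S\<bar> * \<bar>b T\<bar>)"
  proof (intro sum.cong refl)
    fix S T assume "S \<in> Pow {..<m}" "T \<in> Pow {..<m}"
    then have "sym_diff S T \<in> Pow {..<m}" by auto
    then show "(\<Sum>R\<in>Pow {..<m}. if sym_diff S T = R then \<bar>a S\<bar> * \<bar>b T\<bar> else 0) = \<bar>a S\<bar> * \<bar>b T\<bar>"
      by (subst sum.delta') auto
  qed
  also have "\<dots> = (\<Sum>S\<in>Pow {..<m}. \<bar>a S\<bar>) * (\<Sum>T\<in>Pow {..<m}. \<bar>b T\<bar>)"
    by (simp add: sum_product)
  finally show ?thesis .
qed

lemma spin_lie_carrier: "spin_lie m A \<in> carrier (Cl m)"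
  unfolding Cl_def spin_lie_def by (auto intro!: sum.neutral)

lemma summable_spin_exp:
  "summable (\<lambda>k. \<bar>(spin_lie m A [^]\<^bsub>Cl m\<^esub> (k::nat)) S / fact k\<bar>)"
proof -
  interpret monoid "Cl m" by (rule monoid_Cl)
  define N where "N a = (\<Sum>S\<in>Pow {..<m}. \<bar>a S\<bar>)" for a :: clifford
  let ?b = "spin_lie m A"
  have "N (?b [^]\<^bsub>Cl m\<^esub> k) \<le> N ?b ^ k" for k :: nat
  proof (induction k)
    case 0
    have "N \<one>\<^bsub>Cl m\<^esub> = (\<Sum>S\<in>Pow {..<m}. if S = {} then 1 else 0)"
      unfolding N_def Cl_def by (intro sum.cong) auto
    then show ?case by (simp add: sum.delta)
  next
    case (Suc k)
    have "N (?b [^]\<^bsub>Cl m\<^esub> Suc k) = N (cl_mult m (?b [^]\<^bsub>Cl m\<^esub> k) ?b)"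
      by (simp add: Cl_def)
    also have "\<dots> \<le> N (?b [^]\<^bsub>Cl m\<^esub> k) * N ?b" unfolding N_def by (rule cl_norm_mult)
    also have "\<dots> \<le> N ?b ^ k * N ?b"
      using Suc by (intro mult_right_mono) (auto simp: N_def sum_nonneg)
    finally show ?case by (simp add: mult.commute)
  qed
  moreover have "\<bar>a S\<bar> \<le> N a" if "a \<in> carrier (Cl m)" for a
  proof (cases "S \<in> Pow {..<m}")
    case True
    then show ?thesis unfolding N_def by (intro member_le_sum[of S _ "\<lambda>S. \<bar>a S\<bar>"]) auto
  next
    case False
    then show ?thesis using that by (auto simp: Cl_def N_def intro!: sum_nonneg)
  qed
  ultimately have "\<bar>(?b [^]\<^bsub>Cl m\<^esub> k) S\<bar> \<le> N ?b ^ k" for k :: nat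
    using nat_pow_closed[OF spin_lie_carrier] by (meson order.trans)
  then have "norm \<bar>(?b [^]\<^bsub>Cl m\<^esub> k) S / fact k\<bar> \<le> inverse (fact k) * N ?b ^ k" for k :: nat
    by (simp add: field_simps divide_right_mono)
  then show ?thesis
    by (intro summable_comparison_test'[OF summable_exp[of "N ?b"], of 0]) auto
qed

lemma sum_matrices_carrier [simp, intro]: "sum_matrices m F J \<in> carrier_mat m m"
  by (simp add: sum_matrices_def)

lemma E_carrier [simp, intro]: "E n i \<in> carrier_mat (2 * n) (2 * n)"
  by (simp add: E_def)

lemma H_carrier [simp, intro]: "H n i \<in> carrier_mat (2 * n) (2 * n)"
  by (auto simp: H_def intro!: smult_carrier_mat minus_carrier_mat add_carrier_mat)

lemma L_E:
  assumes "i \<in> {1..n}" "j \<in> {1..n}"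
  shows "L n i (E n j) = (if i = j then \<i> else 0)"
  using assms by (auto simp: L_def E_def)


lemma cnj_e_vec:
  assumes "k \<in> {1..n}"
  shows "map_vec cnj (e_vec n k) = e_vec n (n + k)"
  using assms by (intro eq_vecI) (auto simp: e_vec_def)

lemma e_vec_pairing:
  assumes "k \<in> {1..2 * n}" "l \<in> {1..2 * n}"
  shows "e_vec n k \<bullet> e_vec n l = (if l = n + k \<or> k = n + l then 1 else 0)"
proof -
  define p where "p k = (if k \<le> n then k - 1 else k - n - 1)" for k
  define c where "c k = (if k \<le> n then - \<i> else \<i>)" for k
  have p: "p k < n" if "k \<in> {1..2 * n}" for k using that by (auto simp: p_def)
  have e: "e_vec n k $ r = ((if r = p k then 1 else 0) + (if r = n + p k then c k else 0)) / sqrt 2"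
    if "k \<in> {1..2 * n}" "r < 2 * n" for k r
    using that by (auto simp: e_vec_def p_def c_def)
  have s2: "complex_of_real (sqrt 2) * complex_of_real (sqrt 2) = 2"
    by (simp flip: of_real_mult)
  have "e_vec n k \<bullet> e_vec n l = (\<Sum>r<2*n. e_vec n k $ r * e_vec n l $ r)"
    by (simp add: scalar_prod_def atLeast0LessThan e_vec_def)
  also have "\<dots> = (\<Sum>r<2*n. (if r = p k then if p k = p l then 1/2 else 0 else 0)
      + (if r = n + p k then if p k = p l then c k * c l / 2 else 0 else 0))"
    using p[OF assms(1)] p[OF assms(2)] assms
    by (intro sum.cong refl) (auto simp: e s2)
  also have "\<dots> = (if p k = p l then (1 + c k * c l) / 2 else 0)"
    using p[OF assms(1)] by (simp add: sum.distrib add_divide_distrib)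
  also have "\<dots> = (if l = n + k \<or> k = n + l then 1 else 0)"
    using assms by (auto simp: p_def c_def)
  finally show ?thesis .
qed

lemma E_mult_e_vec:
  assumes "i \<in> {1..n}" "k \<in> {1..2 * n}"
  shows "map_mat complex_of_real (E n i) *\<^sub>v e_vec n k =
    (if k = i then \<i> else if k = n + i then - \<i> else 0) \<cdot>\<^sub>v e_vec n k"
proof (rule eq_vecI)
  fix r assume "r < dim_vec ((if k = i then \<i> else if k = n + i then - \<i> else 0) \<cdot>\<^sub>v e_vec n k)"
  then have r: "r < 2 * n" by (simp add: e_vec_def)
  obtain l where l: "i = Suc l" "l < n" using assms(1) by (cases i) auto
  have "(map_mat complex_of_real (E n i) *\<^sub>v e_vec n k) $ r
      = (\<Sum>c<2*n. complex_of_real (E n i $$ (r, c)) * e_vec n k $ c)"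
    using r by (simp add: E_def e_vec_def scalar_prod_def atLeast0LessThan)
  also have "\<dots> = (\<Sum>c<2*n. (if c = l then if r = n + l then e_vec n k $ l else 0 else 0)
       + (if c = n + l then if r = l then - e_vec n k $ (n + l) else 0 else 0))"
    using l r by (intro sum.cong refl) (auto simp: E_def)
  also have "\<dots> = (if r = n + l then e_vec n k $ l else 0)
       + (if r = l then - e_vec n k $ (n + l) else 0)"
    using l by (simp add: sum.distrib)
  also have "\<dots> = (if k = i then \<i> else if k = n + i then - \<i> else 0) * e_vec n k $ r"
    using assms(2) l r by (cases k) (auto simp: e_vec_def)
  finally show "(map_mat complex_of_real (E n i) *\<^sub>v e_vec n k) $ r =
    ((if k = i then \<i> else if k = n + i then - \<i> else 0) \<cdot>\<^sub>v e_vec n k) $ r"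
    using r by (simp add: e_vec_def)
qed (simp add: E_def e_vec_def)

lemma torus_alg_subset_so: "torus_alg n \<subseteq> so (2 * n)"
proof
  fix \<xi> assume "\<xi> \<in> torus_alg n"
  then obtain a where \<xi>: "\<xi> = sum_matrices (2 * n) (\<lambda>i. a i \<cdot>\<^sub>m E n i) {1..n}"
    unfolding torus_alg_def by auto
  have E: "E n i $$ (c, r) = - (E n i $$ (r, c))" if b: "r < 2 * n" "c < 2 * n" "i \<in> {1..n}" for i r c
  proof -
    obtain l where l: "i = Suc l" "l < n" using b(3) by (cases i) auto
    have *: "E n i $$ (r, c) = (if r = n + l \<and> c = l then 1 else if r = l \<and> c = n + l then - 1 else 0)"
      if "r < 2 * n" "c < 2 * n" for r c
      using that unfolding l E_def by simp
    show ?thesis unfolding *[OF b(1,2)] *[OF b(2,1)] using l(2) by auto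
  qed
  have skew: "\<xi> $$ (c, r) = - (\<xi> $$ (r, c))" if "r < 2 * n" "c < 2 * n" for r c
  proof -
    have ent: "\<xi> $$ (r, c) = (\<Sum>i\<in>{1..n}. a i * E n i $$ (r, c))" if "r < 2 * n" "c < 2 * n" for r c
      using that unfolding \<xi> sum_matrices_def by (simp add: carrier_matD[OF E_carrier])
    show ?thesis
      unfolding ent[OF that] ent[OF that(2,1)] sum_negf[symmetric]
      by (intro sum.cong refl) (simp only: E[OF that] mult_minus_right)
  qed
  have c: "\<xi> \<in> carrier_mat (2 * n) (2 * n)" unfolding \<xi> by (rule sum_matrices_carrier)
  have "\<xi>\<^sup>T = - \<xi>"
  proof (rule eq_matI)
    fix r s assume "r < dim_row (- \<xi>)" "s < dim_col (- \<xi>)"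
    then have rs: "r < 2 * n" "s < 2 * n" using c by auto
    show "\<xi>\<^sup>T $$ (r, s) = (- \<xi>) $$ (r, s)"
      using rs c skew[OF rs] by auto
  qed (use c in auto)
  then show "\<xi> \<in> so (2 * n)" using c by (simp add: so_def)
qed

lemma L_sum_matrices:
  assumes "i \<in> {1..n}"
  shows "L n i (sum_matrices (2 * n) F J) = (\<Sum>j\<in>J. L n i (F j))"
  using assms by (auto simp: L_def sum_matrices_def sum_distrib_left)

lemma L_H:
  assumes "i \<in> {1..n}" "j \<in> {1..n}" "n \<ge> 2"
  shows "L n i (H n j) =
    (if j \<le> n - 2 then (if i \<le> j then \<i> else 0)
     else if i < n then \<i> / 2 else if j = n then \<i> / 2 else - \<i> / 2)"
proof -
  have S: "L n i (sum_matrices (2 * n) (E n) {1..k}) = (if i \<le> k then \<i> else 0)" if "k \<le> n" for k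
  proof -
    have "L n i (sum_matrices (2 * n) (E n) {1..k}) = (\<Sum>j\<in>{1..k}. if i = j then \<i> else 0)"
      unfolding L_sum_matrices[OF assms(1)] using assms that by (intro sum.cong) (auto simp: L_E)
    then show ?thesis using assms(1) by simp
  qed
  have A: "L n k ((1/2) \<cdot>\<^sub>m (M + N)) = (L n k M + L n k N) / 2"
    "L n k ((1/2) \<cdot>\<^sub>m (M - N)) = (L n k M - L n k N) / 2"
    if "M \<in> carrier_mat (2*n) (2*n)" "N \<in> carrier_mat (2*n) (2*n)" "k \<in> {1..n}" for M N k
    using that by (auto simp: L_def algebra_simps)
  show ?thesis
    unfolding H_def using assms S[of j] S[of "n-1"] L_E[of i n n]
    by (auto simp: A)
qed

lemma simple_root_H:
  assumes "i \<in> {1..n}" "j \<in> {1..n}" "n \<ge> 3"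
  shows "simple_root n i (H n j) = (if i = j then \<i> else 0)"
proof (cases "i < n")
  case True
  then have i: "i \<in> {1..n}" "i + 1 \<in> {1..n}" and n: "n \<ge> 2" using assms by auto
  show ?thesis
    unfolding simple_root_def L_H[OF i(1) assms(2) n] L_H[OF i(2) assms(2) n]
    using True assms by (cases "j \<le> n - 2"; cases "j = n") (simp_all, linarith)
next
  case False
  then have i: "i = n" "n - 1 \<in> {1..n}" "n \<in> {1..n}" and n: "n \<ge> 2" using assms by auto
  show ?thesis
    unfolding simple_root_def L_H[OF i(2) assms(2) n] L_H[OF i(3) assms(2) n]
    using i(1) assms by (cases "j \<le> n - 2"; cases "j = n") simp_all
qed

end

theory Submission
  imports Defs "Jordan_Normal_Form.Determinant"
begin

text \<open>
Everything is read off from coordinates.  Write a torus element as \<open>\<Sum> a_i E_i = \<Sum> c_i H_i\<close>;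
then \<open>c_i = a_i - a_(i+1)\<close> for \<open>i < n\<close> and \<open>c_n = a_(n-1) + a_n\<close>.

Integrality.  The exponential of \<open>2 \<pi> \<Sum> a_i E_i\<close> is the product of the commuting factors
\<open>cos (\<pi> a_i) + sin (\<pi> a_i) x_i x_(n+i)\<close>.  It equals 1 exactly when all \<open>a_i\<close> are integers with
an even sum (\<open>toral_in_integral_lattice_iff\<close>).  In the coordinates \<open>c\<close>, with
\<open>S = \<Sum> i c_i\<close> over \<open>i \<le> n - 2\<close>, this becomes the congruence \<open>spin_cond\<close>: for odd \<open>n\<close>, 4 divides
\<open>2 S + c_n - c_(n-1)\<close>; for even \<open>n\<close>, both \<open>c_(n-1) + c_n\<close> and \<open>S + c_(n-1)\<close> are even.

Order.  The algebra \<open>so(2n, \<complex>)\<close> is spanned by the \<open>e_k \<and> e_l\<close>, on which \<open>ad \<xi>\<close> acts by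
\<open>\<i>\<close> times the sum of the weights of \<open>e_k\<close> and \<open>e_l\<close>.  Hence an inclusion between filtration
steps is an implication between inequalities of such sums (\<open>p_filtration_toral_subset_iff\<close>), and
since every root is up to sign a nonnegative combination of simple roots, the order on dominant
integral elements is the reversed coordinatewise order of the \<open>c_i\<close> (\<open>canonical_le_H_comb_iff\<close>).

So an \<open>I\<close>-canonical element is \<open>\<xi>_I + \<Sum> d_i H_i\<close>, where \<open>d\<close> is a minimal vector of natural numbers,
supported in \<open>I\<close>, for which \<open>1 + d\<close> on \<open>I\<close> satisfies the congruence
(\<open>canonical_elements_eqI\<close>).  The congruence depends on \<open>d\<close> only through \<open>d_(n-1)\<close>, \<open>d_n\<close> and the
parity of \<open>\<Sum> i d_i\<close> over \<open>i \<le> n - 2\<close>, to which only odd \<open>i\<close> contribute.  Its minimal solutions are then found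
separately according to how many of \<open>n - 1\<close> and \<open>n\<close> belong to \<open>I\<close>.
\<close>

section \<open>Torus elements and their exponential in Spin(2n)\<close>

definition toral :: "nat \<Rightarrow> (nat \<Rightarrow> real) \<Rightarrow> real mat" where
  "toral n a = sum_matrices (2 * n) (\<lambda>i. a i \<cdot>\<^sub>m E n i) {1..n}"

lemma toral_carrier [simp, intro]: "toral n a \<in> carrier_mat (2 * n) (2 * n)"
  by (simp add: toral_def)

lemma toral_entry:
  assumes "r < 2 * n" "c < 2 * n"
  shows "toral n a $$ (r, c) = (if r = n + c then a (Suc c) else if c = n + r then - a (Suc r) else 0)"
proof -
  have "toral n a $$ (r, c) = (\<Sum>i\<in>{1..n}. a i * E n i $$ (r, c))"
    using assms by (simp add: toral_def sum_matrices_def carrier_matD[OF E_carrier])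
  also have "\<dots> = (\<Sum>i\<in>{1..n}. (if i = Suc c then if r = n + c then a i else 0 else 0)
      + (if i = Suc r then if c = n + r then - a i else 0 else 0))"
  proof (intro sum.cong refl)
    fix i assume "i \<in> {1..n}"
    then obtain l where l: "i = Suc l" "l < n" by (cases i) auto
    show "a i * E n i $$ (r, c) = (if i = Suc c then if r = n + c then a i else 0 else 0)
      + (if i = Suc r then if c = n + r then - a i else 0 else 0)"
      using assms l by (auto simp: E_def)
  qed
  also have "\<dots> = (if r = n + c then a (Suc c) else if c = n + r then - a (Suc r) else 0)"
    using assms by (auto simp: sum.distrib)
  finally show ?thesis .
qed

lemma smult_toral: "k \<cdot>\<^sub>m toral n a = toral n (\<lambda>i. k * a i)"
  by (rule eq_matI) (auto simp: toral_entry carrier_matD[OF toral_carrier])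

lemma toral_cong:
  assumes "\<And>i. i \<in> {1..n} \<Longrightarrow> a i = b i"
  shows "toral n a = toral n b"
  by (rule eq_matI) (auto simp: toral_entry carrier_matD[OF toral_carrier] assms)

lemma torus_alg_eq: "torus_alg n = range (toral n)"
  by (auto simp: torus_alg_def toral_def)

lemma L_toral: "i \<in> {1..n} \<Longrightarrow> L n i (toral n a) = \<i> * of_real (a i)"
  by (auto simp: L_def toral_entry)

text \<open>
Fourier analysis on the torus of signs.  The commuting square roots \<open>x_i x_(n+i)\<close> of \<open>-1\<close> have
joint eigenvalues \<open>u B i = \<plusminus> \<i>\<close>, one system for each set \<open>B\<close> of indices with sign \<open>+\<close>.  The sum over all
systems factors over the indices because \<open>\<Prod> (f_i + g_i)\<close> expands into a sum over subsets.
\<close>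

lemma sum_signs_exp:
  fixes \<theta> :: "nat \<Rightarrow> real"
  assumes "A \<subseteq> {..<n}"
  defines "u \<equiv> \<lambda>B i. if i \<in> B then \<i> else - \<i>"
  shows "(\<Sum>B\<in>Pow {..<n}. (\<Prod>i\<in>A. - u B i) * exp (\<Sum>i<n. u B i * of_real (\<theta> i)))
    = 2 ^ n * of_real ((\<Prod>i\<in>A. sin (\<theta> i)) * (\<Prod>i\<in>{..<n} - A. cos (\<theta> i)))"
proof -
  define f where "f i = (if i \<in> A then - \<i> else 1) * exp (\<i> * of_real (\<theta> i))" for i
  define g where "g i = (if i \<in> A then \<i> else 1) * exp (- \<i> * of_real (\<theta> i))" for i
  have fg: "f i + g i = 2 * of_real (if i \<in> A then sin (\<theta> i) else cos (\<theta> i))" for i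
  proof -
    have "exp (\<i> * of_real (\<theta> i)) = cis (\<theta> i)" "exp (- \<i> * of_real (\<theta> i)) = cis (- \<theta> i)"
      by (simp_all add: cis_conv_exp)
    then show ?thesis unfolding f_def g_def by (simp add: complex_eq_iff)
  qed
  have "(\<Prod>i\<in>A. - u B i) * exp (\<Sum>i<n. u B i * of_real (\<theta> i)) = prod f B * prod g ({..<n} - B)"
    if "B \<in> Pow {..<n}" for B
  proof -
    have "(\<Prod>i\<in>A. - u B i) = (\<Prod>i<n. if i \<in> A then - u B i else 1)"
      using assms(1) by (simp add: prod.If_cases Int_absorb1)
    then have "(\<Prod>i\<in>A. - u B i) * exp (\<Sum>i<n. u B i * of_real (\<theta> i))
      = (\<Prod>i<n. (if i \<in> A then - u B i else 1) * exp (u B i * of_real (\<theta> i)))"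
      by (simp add: exp_sum prod.distrib)
    also have "\<dots> = (\<Prod>i<n. if i \<in> B then f i else g i)"
      by (intro prod.cong) (auto simp: f_def g_def u_def)
    also have "\<dots> = prod f B * prod g ({..<n} - B)"
      using that by (simp add: prod.If_cases Int_absorb1 Diff_eq)
    finally show ?thesis .
  qed
  then have "(\<Sum>B\<in>Pow {..<n}. (\<Prod>i\<in>A. - u B i) * exp (\<Sum>i<n. u B i * of_real (\<theta> i)))
    = (\<Sum>B\<in>Pow {..<n}. prod f B * prod g ({..<n} - B))"
    by (intro sum.cong) auto
  also have "\<dots> = (\<Prod>i<n. f i + g i)" by (rule prod_add[symmetric]) simp
  also have "\<dots> = 2 ^ n * of_real (\<Prod>i<n. if i \<in> A then sin (\<theta> i) else cos (\<theta> i))"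
    by (simp add: fg prod.distrib)
  also have "(\<Prod>i<n. if i \<in> A then sin (\<theta> i) else cos (\<theta> i))
    = (\<Prod>i\<in>A. sin (\<theta> i)) * (\<Prod>i\<in>{..<n} - A. cos (\<theta> i))"
    using assms(1) by (simp add: prod.If_cases Int_absorb1 Diff_eq)
  finally show ?thesis .
qed

text \<open>
The bivector of a torus element involves only the monomials with index sets \<open>{i, n + i}\<close>, so a
product with it collects a single term for each \<open>i\<close>.
\<close>

lemma cl_mult_spin_lie_toral:
  assumes "R \<subseteq> {..<2 * n}"
  shows "cl_mult (2 * n) a (spin_lie (2 * n) (toral n t)) R =
    (\<Sum>i<n. cl_sign (sym_diff R {i, n + i}) {i, n + i} * a (sym_diff R {i, n + i}) * (t (Suc i) / 2))"
proof -
  define F where "F T = (\<Sum>S\<in>Pow {..<2 * n}. if sym_diff S T = R then cl_sign S T * a S else 0)" for T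
  have F: "F T = cl_sign (sym_diff R T) T * a (sym_diff R T)" if "T \<subseteq> {..<2 * n}" for T
  proof -
    have iff: "sym_diff S T = R \<longleftrightarrow> S = sym_diff R T" for S by blast
    show ?thesis
      unfolding F_def iff using that assms by (subst sum.delta) auto
  qed
  have "cl_mult (2 * n) a (spin_lie (2 * n) (toral n t)) R
    = (\<Sum>i<2*n. \<Sum>j<2*n. if i < j then F {i, j} * (toral n t $$ (j, i) / 2) else 0)"
    unfolding cl_mult_right F_def[symmetric] by (rule sum_spin_lie)
  also have "\<dots> = (\<Sum>i<2*n. \<Sum>j<2*n. if j = n + i then F {i, j} * (t (Suc i) / 2) else 0)"
    by (intro sum.cong refl) (auto simp: toral_entry)
  also have "\<dots> = (\<Sum>i<2*n. if i < n then F {i, n + i} * (t (Suc i) / 2) else 0)"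
    by (intro sum.cong refl) (auto simp: sum.delta)
  also have "\<dots> = (\<Sum>i<n. F {i, n + i} * (t (Suc i) / 2))"
    by (intro sum.mono_neutral_cong_right) auto
  finally show ?thesis by (simp add: F)
qed

text \<open>
Index set of the monomial \<open>\<Prod> x_i x_(n+i)\<close> over \<open>i\<close> in \<open>A\<close>.
\<close>

definition paired :: "nat \<Rightarrow> nat set \<Rightarrow> nat set" where
  "paired n A = A \<union> (+) n ` A"

lemma paired_sym_diff:
  assumes "A \<subseteq> {..<n}" "i < n"
  shows "sym_diff (paired n A) {i, n + i} = paired n (sym_diff A {i})"
  using assms by (auto simp: paired_def)

text \<open>
Each \<open>s\<close> in \<open>A\<close> contributes an odd number of the inequalities counted by the sign: \<open>i \<le> n + s\<close> always
holds, \<open>n + i \<le> s\<close> never does, and \<open>i \<le> s\<close> holds together with \<open>n + i \<le> n + s\<close>.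
\<close>

lemma cl_sign_paired:
  assumes "A \<subseteq> {..<n}" "i < n"
  shows "cl_sign (paired n A) {i, n + i} = (-1) ^ card A"
proof -
  have fin: "finite A" using assms(1) finite_subset by auto
  have "cl_sign (paired n A) {i, n + i} =
    (\<Prod>s\<in>paired n A. (if i \<le> s then -1 else 1) * (if n + i \<le> s then -1 else 1))"
    using fin assms by (subst cl_sign_eq_prod) (auto simp: paired_def)
  also have "\<dots> = (\<Prod>s\<in>A. (if i \<le> s then -1 else 1) * (if n + i \<le> s then -1 else 1)) *
     (\<Prod>s\<in>A. (if i \<le> n + s then -1 else 1) * (if n + i \<le> n + s then -1 else 1))"
    unfolding paired_def using fin assms(1)
    by (subst prod.union_disjoint) (auto simp: prod.reindex)
  also have "\<dots> = (\<Prod>s\<in>A. -1)"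
    unfolding prod.distrib[symmetric] using assms by (intro prod.cong) auto
  finally show ?thesis by simp
qed

text \<open>
The powers generate a commutative algebra that is diagonalised by the joint eigenvalues \<open>u B\<close>, so
each coefficient is a Fourier coefficient of a power of the eigenvalue \<open>\<Sum> u B i t_i / 2\<close>.  The
sign with the binomial coefficient \<open>card A choose 2\<close> compares the monomial with increasing indices
with the product of the factors \<open>x_i x_(n+i)\<close>.
\<close>

lemma spin_lie_toral_power:
  fixes t :: "nat \<Rightarrow> real"
  assumes "R \<subseteq> {..<2 * n}"
  defines "u \<equiv> \<lambda>B i. if i \<in> B then \<i> else - \<i>"
  shows "of_real ((spin_lie (2 * n) (toral n t) [^]\<^bsub>Cl (2 * n)\<^esub> (k::nat)) R) =
    (if \<exists>A\<subseteq>{..<n}. R = paired n A then (-1) ^ (card (R \<inter> {..<n}) choose 2) / 2 ^ n *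
       (\<Sum>B\<in>Pow {..<n}. (\<Prod>i\<in>R \<inter> {..<n}. - u B i) * (\<Sum>i<n. u B i * of_real (t (Suc i) / 2)) ^ k)
     else 0)"
  using assms(1)
proof (induction k arbitrary: R)
  case 0
  have [simp]: "paired n A \<inter> {..<n} = A" if "A \<subseteq> {..<n}" for A
    using that by (auto simp: paired_def)
  show ?case
  proof (cases "\<exists>A\<subseteq>{..<n}. R = paired n A")
    case True
    then obtain A where A: "A \<subseteq> {..<n}" "R = paired n A" by blast
    have fin: "finite A" using A(1) finite_subset by auto
    have "(\<Sum>B\<in>Pow {..<n}. \<Prod>i\<in>A. - u B i) = 2 ^ n * of_real (\<Prod>i\<in>A. 0)"
      using sum_signs_exp[OF A(1), of "\<lambda>_. 0"] by (simp add: u_def)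
    moreover have "R = {} \<longleftrightarrow> A = {}" using A(2) by (auto simp: paired_def)
    ultimately show ?thesis
      using A fin by (cases "A = {}") (auto simp: Cl_def numeral_2_eq_2)
  next
    case False
    then have "R \<noteq> {}" by (auto simp: paired_def)
    then show ?thesis using False by (auto simp: Cl_def)
  qed
next
  case (Suc k)
  let ?b = "spin_lie (2 * n) (toral n t)"
  define p where "p = ?b [^]\<^bsub>Cl (2 * n)\<^esub> k"
  have rec: "(?b [^]\<^bsub>Cl (2 * n)\<^esub> Suc k) R =
    (\<Sum>i<n. cl_sign (sym_diff R {i, n + i}) {i, n + i} * p (sym_diff R {i, n + i}) * (t (Suc i) / 2))"
    using cl_mult_spin_lie_toral[OF Suc.prems] by (simp add: Cl_def p_def)
  have sub: "sym_diff R {i, n + i} \<subseteq> {..<2*n}" if "i < n" for i using Suc.prems that by auto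
  have cap [simp]: "paired n A \<inter> {..<n} = A" if "A \<subseteq> {..<n}" for A
    using that by (auto simp: paired_def)
  show ?case
  proof (cases "\<exists>A\<subseteq>{..<n}. R = paired n A")
    case True
    then obtain A where A: "A \<subseteq> {..<n}" "R = paired n A" by blast
    have fin: "finite A" using A(1) finite_subset by auto
    define z where "z B = (\<Sum>i<n. u B i * complex_of_real (t (Suc i) / 2))" for B
    define s where "s A = (-1 :: complex) ^ (card A choose 2)" for A :: "nat set"
    have step: "complex_of_real (cl_sign (sym_diff R {i, n + i}) {i, n + i} * p (sym_diff R {i, n + i}))
        = s A / 2 ^ n * (\<Sum>B\<in>Pow {..<n}. (\<Prod>i\<in>A. - u B i) * u B i * z B ^ k)" if i: "i < n" for i
    proof -
      define A' where "A' = sym_diff A {i}"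
      have A': "A' \<subseteq> {..<n}" using A(1) i by (auto simp: A'_def)
      have R': "sym_diff R {i, n + i} = paired n A'"
        unfolding A(2) A'_def by (rule paired_sym_diff[OF A(1) i])
      \<comment> \<open>Adding or removing the index \<open>i\<close> multiplies the conjugate character \<open>\<Prod> (- u B i)\<close> by \<open>u B i\<close>,
         up to the sign that the monomials account for.\<close>
      have key: "(-1) ^ card A' * s A' * (\<Prod>i\<in>A'. - u B i) = s A * (\<Prod>i\<in>A. - u B i) * u B i" for B
      proof (cases "i \<in> A")
        case True
        then obtain C where C: "A = insert i C" "i \<notin> C" "A' = C" "finite C"
          using fin by (metis A'_def Diff_insert_absorb Un_empty_right finite_insert insert_Diff insert_absorb
             mk_disjoint_insert empty_Diff insert_Diff_if)
        have uu: "u B i * (u B i * x) = - x" for x by (simp add: u_def)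
        show ?thesis using C
          by (simp add: uu s_def numeral_2_eq_2 power_add algebra_simps)
      next
        case False
        then have C: "A' = insert i A" by (auto simp: A'_def)
        show ?thesis using C False fin
          by (simp add: s_def numeral_2_eq_2 power_add algebra_simps flip: power_mult_distrib)
      qed
      have "complex_of_real (cl_sign (sym_diff R {i, n + i}) {i, n + i} * p (sym_diff R {i, n + i}))
        = (-1) ^ card A' * (s A' / 2 ^ n * (\<Sum>B\<in>Pow {..<n}. (\<Prod>i\<in>A'. - u B i) * z B ^ k))"
        using Suc.IH[OF sub[OF i]] A' cl_sign_paired[OF A' i] unfolding R'
        by (auto simp: p_def s_def z_def)
      also have "\<dots> = (\<Sum>B\<in>Pow {..<n}. ((-1) ^ card A' * s A' * (\<Prod>i\<in>A'. - u B i)) * z B ^ k) / 2 ^ n"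
        by (simp add: sum_distrib_left sum_divide_distrib mult_ac)
      also have "\<dots> = s A / 2 ^ n * (\<Sum>B\<in>Pow {..<n}. (\<Prod>i\<in>A. - u B i) * u B i * z B ^ k)"
        unfolding key by (simp add: sum_distrib_left sum_divide_distrib mult_ac)
      finally show ?thesis .
    qed
    have "complex_of_real ((?b [^]\<^bsub>Cl (2 * n)\<^esub> Suc k) R) =
      (\<Sum>i<n. complex_of_real (cl_sign (sym_diff R {i, n + i}) {i, n + i} * p (sym_diff R {i, n + i})) * of_real (t (Suc i) / 2))"
      unfolding rec of_real_sum of_real_mult[symmetric] ..
    also have "\<dots> = (\<Sum>i<n. s A / 2 ^ n * (\<Sum>B\<in>Pow {..<n}. (\<Prod>i\<in>A. - u B i) * u B i * z B ^ k) * of_real (t (Suc i) / 2))"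
      by (intro sum.cong refl) (simp only: step lessThan_iff)
    also have "\<dots> = (\<Sum>B\<in>Pow {..<n}. \<Sum>i<n. s A / 2 ^ n * ((\<Prod>i\<in>A. - u B i) * u B i * z B ^ k) * of_real (t (Suc i) / 2))"
      unfolding sum_distrib_left sum_distrib_right by (rule sum.swap)
    also have "\<dots> = s A / 2 ^ n * (\<Sum>B\<in>Pow {..<n}. (\<Prod>i\<in>A. - u B i) * z B ^ Suc k)"
      unfolding sum_distrib_left
      by (intro sum.cong refl) (simp add: z_def sum_distrib_left sum_distrib_right mult_ac)
    finally show ?thesis using A by (auto simp: s_def z_def)
  next
    case False
    have "p (sym_diff R {i, n + i}) = 0" if i: "i < n" for i
    proof -
      have "\<nexists>A. A \<subseteq> {..<n} \<and> sym_diff R {i, n + i} = paired n A"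
      proof
        assume "\<exists>A. A \<subseteq> {..<n} \<and> sym_diff R {i, n + i} = paired n A"
        then obtain A where A: "A \<subseteq> {..<n}" "sym_diff R {i, n + i} = paired n A" by blast
        have "R = sym_diff (sym_diff R {i, n + i}) {i, n + i}" by auto
        then have "R = paired n (sym_diff A {i})" using paired_sym_diff[OF A(1) i] A(2) by simp
        moreover have "sym_diff A {i} \<subseteq> {..<n}" using A i by auto
        ultimately show False using False by blast
      qed
      then have "complex_of_real (p (sym_diff R {i, n + i})) = 0"
        using Suc.IH[OF sub[OF i]] unfolding p_def by (simp only: if_False)
      then show ?thesis by simp
    qed
    then have "(?b [^]\<^bsub>Cl (2 * n)\<^esub> Suc k) R = 0" unfolding rec by (intro sum.neutral) auto
    then show ?thesis using False by (simp only: if_False of_real_0)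
  qed
qed


text \<open>
Summing the exponential series turns the powers of the eigenvalues into exponentials, and the
Fourier sum becomes the expansion of \<open>\<Prod> (cos (t_i / 2) + sin (t_i / 2) x_i x_(n+i))\<close>.
\<close>

lemma spin_exp_toral:
  assumes "R \<subseteq> {..<2 * n}"
  shows "spin_exp (2 * n) (toral n t) R = (if \<exists>A\<subseteq>{..<n}. R = paired n A then
      (-1) ^ (card (R \<inter> {..<n}) choose 2) * ((\<Prod>i\<in>R \<inter> {..<n}. sin (t (Suc i) / 2)) *
        (\<Prod>i\<in>{..<n} - R. cos (t (Suc i) / 2))) else 0)"
proof -
  let ?p = "\<lambda>k::nat. (spin_lie (2 * n) (toral n t) [^]\<^bsub>Cl (2 * n)\<^esub> k) R"
  define u where "u = (\<lambda>(B :: nat set) (i :: nat). if i \<in> B then \<i> else - \<i>)"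
  define z where "z B = (\<Sum>i<n. u B i * complex_of_real (t (Suc i) / 2))" for B
  define S where "S = (if \<exists>A\<subseteq>{..<n}. R = paired n A then
      (-1) ^ (card (R \<inter> {..<n}) choose 2) * ((\<Prod>i\<in>R \<inter> {..<n}. sin (t (Suc i) / 2)) *
        (\<Prod>i\<in>{..<n} - R. cos (t (Suc i) / 2))) else 0)"
  have "(\<lambda>k. complex_of_real (?p k / fact k)) sums of_real S"
  proof (cases "\<exists>A\<subseteq>{..<n}. R = paired n A")
    case True
    define A where "A = R \<inter> {..<n}"
    have A: "A \<subseteq> {..<n}" "{..<n} - A = {..<n} - R" by (auto simp: A_def)
    have p: "complex_of_real (?p k / fact k) = (-1) ^ (card A choose 2) / 2 ^ n *
       (\<Sum>B\<in>Pow {..<n}. (\<Prod>i\<in>A. - u B i) * (z B ^ k /\<^sub>R fact k))" for k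
      using spin_lie_toral_power[OF assms, of t k] True
      by (simp add: A_def u_def z_def sum_divide_distrib sum_distrib_left scaleR_conv_of_real field_simps)
    have "(\<lambda>k. complex_of_real (?p k / fact k)) sums ((-1) ^ (card A choose 2) / 2 ^ n *
       (\<Sum>B\<in>Pow {..<n}. (\<Prod>i\<in>A. - u B i) * exp (z B)))"
      unfolding p by (intro sums_mult sums_sum exp_converges)
    moreover have "(\<Sum>B\<in>Pow {..<n}. (\<Prod>i\<in>A. - u B i) * exp (z B))
      = 2 ^ n * of_real ((\<Prod>i\<in>A. sin (t (Suc i) / 2)) * (\<Prod>i\<in>{..<n} - R. cos (t (Suc i) / 2)))"
      using sum_signs_exp[OF A(1), of "\<lambda>i. t (Suc i) / 2"] unfolding z_def u_def A(2) .
    ultimately show ?thesis using True by (simp add: S_def A_def)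
  next
    case False
    then have "?p k = 0" for k
      using spin_lie_toral_power[OF assms, of t k] by (simp only: if_False of_real_eq_0_iff)
    then show ?thesis using False by (auto simp: S_def)
  qed
  then have "(\<lambda>k. ?p k / fact k) sums S" by (simp only: sums_of_real_iff)
  then show ?thesis unfolding spin_exp_def S_def by (rule sums_unique[symmetric])
qed

lemma spin_exp_support:
  assumes "\<not> R \<subseteq> {..<m}"
  shows "spin_exp m A R = 0"
proof -
  interpret monoid "Cl m" by (rule monoid_Cl)
  have "(spin_lie m A [^]\<^bsub>Cl m\<^esub> k) R = 0" for k :: nat
    using nat_pow_closed[OF spin_lie_carrier, of A k] assms by (simp add: Cl_def)
  then show ?thesis by (simp add: spin_exp_def)
qed

lemma cos_sum_of_sin_eq_0:
  fixes x :: "'a \<Rightarrow> real"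
  assumes "finite A" "\<And>i. i \<in> A \<Longrightarrow> sin (x i) = 0"
  shows "cos (sum x A) = (\<Prod>i\<in>A. cos (x i)) \<and> sin (sum x A) = 0"
  using assms by (induction A rule: finite_induct) (auto simp: cos_add sin_add)

text \<open>
With \<open>t_i = 2 \<pi> a_i\<close> the factors are \<open>cos (\<pi> a_i) + sin (\<pi> a_i) x_i x_(n+i)\<close>.  If the product is 1, its
scalar part excludes zero cosines, and then the coefficients of the single \<open>x_i x_(n+i)\<close>
force all sines to vanish.  Once they do, the scalar part is the cosine of \<open>\<pi> \<Sum> a_i\<close>.
\<close>

lemma toral_in_integral_lattice_iff:
  "toral n a \<in> integral_lattice n \<longleftrightarrow>
     (\<forall>i\<in>{1..n}. a i \<in> \<int>) \<and> (\<Sum>i=1..n. a i) / 2 \<in> \<int>"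
proof -
  define th where "th i = pi * a (Suc i)" for i
  define e where "e = spin_exp (2 * n) ((2 * pi) \<cdot>\<^sub>m toral n a)"
  have e: "e R = (if \<exists>A\<subseteq>{..<n}. R = paired n A then
      (-1) ^ (card (R \<inter> {..<n}) choose 2) * ((\<Prod>i\<in>R \<inter> {..<n}. sin (th i)) * (\<Prod>i\<in>{..<n} - R. cos (th i)))
      else 0)" if "R \<subseteq> {..<2 * n}" for R
    unfolding e_def smult_toral spin_exp_toral[OF that] th_def by (auto simp: mult.assoc)
  have int: "a (Suc i) \<in> \<int> \<longleftrightarrow> sin (th i) = 0" for i
    by (auto simp: th_def sin_zero_iff_int2 Ints_def mult.commute)
  have sum: "(\<Sum>i<n. th i) = pi * (\<Sum>i=1..n. a i)"
    unfolding th_def sum_distrib_left using sum.atLeast1_atMost_eq[of "\<lambda>i. pi * a i" n] by simp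
  have half: "(\<Sum>i=1..n. a i) / 2 \<in> \<int> \<longleftrightarrow> cos (\<Sum>i<n. th i) = 1"
    unfolding sum by (auto simp: cos_one_2pi_int Ints_def)
  have all: "(\<forall>i\<in>{1..n}. a i \<in> \<int>) \<longleftrightarrow> (\<forall>i<n. sin (th i) = 0)"
    unfolding int[symmetric] by (auto simp: Ball_def) (metis Suc_le_D Suc_le_lessD Suc_le_mono)
  have e0: "e {} = (\<Prod>i<n. cos (th i))"
    by (subst e) (auto simp: paired_def numeral_2_eq_2)
  have one: "\<one>\<^bsub>Spin (2 * n)\<^esub> R = (if R = {} then 1 else 0)" for R
    by (simp add: Spin_def Cl_def)
  have "e = \<one>\<^bsub>Spin (2 * n)\<^esub> \<longleftrightarrow> (\<forall>i<n. sin (th i) = 0) \<and> cos (\<Sum>i<n. th i) = 1"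
  proof
    assume eq: "e = \<one>\<^bsub>Spin (2 * n)\<^esub>"
    then have prod1: "(\<Prod>i<n. cos (th i)) = 1" using e0 one[of "{}"] by simp
    have "sin (th i) = 0" if "i < n" for i
    proof -
      have "e (paired n {i}) = 0" unfolding eq one by (simp add: paired_def)
      moreover have "paired n {i} \<subseteq> {..<2 * n}" "paired n {i} \<inter> {..<n} = {i}"
        "{..<n} - paired n {i} = {..<n} - {i}" using that by (auto simp: paired_def)
      moreover have "\<exists>A\<subseteq>{..<n}. paired n {i} = paired n A" using that by blast
      ultimately have "sin (th i) = 0 \<or> (\<Prod>i\<in>{..<n} - {i}. cos (th i)) = 0"
        by (simp add: e numeral_2_eq_2)
      moreover have "(\<Prod>i\<in>{..<n} - {i}. cos (th i)) \<noteq> 0"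
        using prod1 prod.remove[of "{..<n}" i "\<lambda>i. cos (th i)"] that by (metis finite_lessThan lessThan_iff mult_zero_right zero_neq_one)
      ultimately show ?thesis by blast
    qed
    then show "(\<forall>i<n. sin (th i) = 0) \<and> cos (\<Sum>i<n. th i) = 1"
      using prod1 cos_sum_of_sin_eq_0[of "{..<n}" th] by simp
  next
    assume h: "(\<forall>i<n. sin (th i) = 0) \<and> cos (\<Sum>i<n. th i) = 1"
    then have prod1: "(\<Prod>i<n. cos (th i)) = 1"
      using cos_sum_of_sin_eq_0[of "{..<n}" th] by simp
    show "e = \<one>\<^bsub>Spin (2 * n)\<^esub>"
    proof
      fix R
      show "e R = \<one>\<^bsub>Spin (2 * n)\<^esub> R"
      proof (cases "R \<subseteq> {..<2 * n} \<and> R \<noteq> {}")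
        case True
        have "(\<Prod>i\<in>R \<inter> {..<n}. sin (th i)) = 0" if ex: "\<exists>A\<subseteq>{..<n}. R = paired n A"
        proof -
          obtain i where "i \<in> R \<inter> {..<n}" using ex True by (auto simp: paired_def)
          then show ?thesis using h by (intro prod_zero) auto
        qed
        then show ?thesis using True by (simp add: e one)
      next
        case False
        then show ?thesis
          using e0 prod1 spin_exp_support[of R "2 * n"] by (cases "R = {}") (auto simp: one e_def)
      qed
    qed
  qed
  then show ?thesis unfolding integral_lattice_def torus_alg_eq e_def all half by auto
qed

section \<open>Root spaces and the filtration of the complexified Lie algebra\<close>

text \<open>
Weight of \<open>e_(k+1)\<close>: it is counted from 0 to agree with matrix indices, and \<open>e_(n+i)\<close> has the weight
opposite to that of \<open>e_i\<close>.
\<close>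

definition weight :: "nat \<Rightarrow> (nat \<Rightarrow> real) \<Rightarrow> nat \<Rightarrow> real" where
  "weight n a k = (if k < n then a (Suc k) else - a (Suc k - n))"

definition e_basis :: "nat \<Rightarrow> complex mat" where
  "e_basis n = mat (2 * n) (2 * n) (\<lambda>(r, k). e_vec n (Suc k) $ r)"

text \<open>
The basis \<open>e\<close> is unitary, so its conjugate transpose is its inverse.
\<close>

definition e_dual :: "nat \<Rightarrow> complex mat" where
  "e_dual n = (map_mat cnj (e_basis n))\<^sup>T"

text \<open>
The coefficients \<open>Y\<close> in \<open>X = \<Sum> Y_(k l) e_k e_l\<^sup>T\<close>.  This congruence, rather than a conjugation, is the
change of basis on the tensor square; it preserves skew symmetry, so that \<open>so(2n, \<complex>)\<close> becomes the
exterior square with the root vectors \<open>e_k \<and> e_l\<close>.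
\<close>

definition root_coords :: "nat \<Rightarrow> complex mat \<Rightarrow> complex mat" where
  "root_coords n X = e_dual n * X * (e_dual n)\<^sup>T"

definition from_root_coords :: "nat \<Rightarrow> complex mat \<Rightarrow> complex mat" where
  "from_root_coords n Y = e_basis n * Y * (e_basis n)\<^sup>T"

lemma e_basis_carrier [simp, intro]: "e_basis n \<in> carrier_mat (2 * n) (2 * n)"
  by (simp add: e_basis_def)

lemma e_dual_carrier [simp, intro]: "e_dual n \<in> carrier_mat (2 * n) (2 * n)"
  by (simp add: e_dual_def e_basis_def)

lemma root_coords_carrier [simp, intro]: "root_coords n X \<in> carrier_mat (2 * n) (2 * n)"
  by (rule carrier_matI) (simp_all add: root_coords_def carrier_matD[OF e_dual_carrier])

lemma from_root_coords_carrier [simp, intro]: "from_root_coords n X \<in> carrier_mat (2 * n) (2 * n)"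
  by (rule carrier_matI) (simp_all add: from_root_coords_def carrier_matD[OF e_basis_carrier])

lemma e_dual_e_basis: "e_dual n * e_basis n = 1\<^sub>m (2 * n)"
proof (rule eq_matI)
  fix k l assume "k < dim_row (1\<^sub>m (2 * n) :: complex mat)" "l < dim_col (1\<^sub>m (2 * n) :: complex mat)"
  then have kl: "k < 2 * n" "l < 2 * n" by auto
  define k' where "k' = (if k < n then n + Suc k else Suc k - n)"
  have k': "k' \<in> {1..2 * n}" using kl by (auto simp: k'_def)
  have cnj: "cnj (e_vec n (Suc k) $ r) = e_vec n k' $ r" if "r < 2 * n" for r
    using that kl unfolding k'_def e_vec_def by (cases "k < n") (auto simp: Suc_diff_le)
  \<comment> \<open>Conjugation exchanges \<open>e_i\<close> and \<open>e_(n+i)\<close>, which are paired by the bilinear form.\<close>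
  have "(e_dual n * e_basis n) $$ (k, l) = (\<Sum>r<2*n. e_vec n k' $ r * e_vec n (Suc l) $ r)"
    using kl by (simp add: e_dual_def e_basis_def scalar_prod_def atLeast0LessThan cnj)
  also have "\<dots> = e_vec n k' \<bullet> e_vec n (Suc l)"
    by (simp add: scalar_prod_def atLeast0LessThan e_vec_def)
  also have "\<dots> = (if k = l then 1 else 0)"
    using kl by (subst e_vec_pairing[OF k']) (auto simp: k'_def)
  finally show "(e_dual n * e_basis n) $$ (k, l) = 1\<^sub>m (2 * n) $$ (k, l)" using kl by simp
qed (auto simp: e_dual_def e_basis_def)

lemma e_basis_e_dual: "e_basis n * e_dual n = 1\<^sub>m (2 * n)"
  by (rule mat_mult_left_right_inverse[OF e_dual_carrier e_basis_carrier e_dual_e_basis])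

lemma congruence_inverse:
  fixes M M' X :: "'a::comm_ring_1 mat"
  assumes c: "M \<in> carrier_mat m m" "M' \<in> carrier_mat m m" "X \<in> carrier_mat m m"
    and inv: "M * M' = 1\<^sub>m m"
  shows "M * (M' * X * M'\<^sup>T) * M\<^sup>T = X"
proof -
  have t: "M'\<^sup>T * M\<^sup>T = 1\<^sub>m m"
    using transpose_mult[OF c(1,2)] inv by simp
  have "M * (M' * X * M'\<^sup>T) * M\<^sup>T = (M * M') * X * (M'\<^sup>T * M\<^sup>T)"
    using c by (simp add: assoc_mult_mat[of _ m m _ m _ m] mult_carrier_mat[of _ m m _ m])
  then show ?thesis using c by (simp add: t inv)
qed

lemma from_root_coords_inverse:
  "X \<in> carrier_mat (2 * n) (2 * n) \<Longrightarrow> from_root_coords n (root_coords n X) = X"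
  unfolding from_root_coords_def root_coords_def
  by (rule congruence_inverse[OF _ _ _ e_basis_e_dual]) auto

lemma root_coords_inverse:
  "Y \<in> carrier_mat (2 * n) (2 * n) \<Longrightarrow> root_coords n (from_root_coords n Y) = Y"
  unfolding from_root_coords_def root_coords_def
  by (rule congruence_inverse[OF _ _ _ e_dual_e_basis]) auto

lemma root_coords_eqI:
  assumes "X \<in> carrier_mat (2 * n) (2 * n)" "X' \<in> carrier_mat (2 * n) (2 * n)"
    and "\<And>k l. k < 2 * n \<Longrightarrow> l < 2 * n \<Longrightarrow> root_coords n X $$ (k, l) = root_coords n X' $$ (k, l)"
  shows "X = X'"
proof -
  have "root_coords n X = root_coords n X'"
    using assms(3) by (intro eq_matI) (auto simp: carrier_matD[OF root_coords_carrier])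
  then show ?thesis using from_root_coords_inverse assms(1,2) by metis
qed

lemma congruence_entry:
  assumes "M \<in> carrier_mat m m" "X \<in> carrier_mat m m" "k < m" "l < m"
  shows "(M * X * M\<^sup>T) $$ (k, l) = (\<Sum>r<m. \<Sum>s<m. M $$ (k, r) * X $$ (r, s) * M $$ (l, s))"
  using assms by (simp add: scalar_prod_def atLeast0LessThan sum_distrib_left mult.assoc)

lemma congruence_skew:
  assumes "M \<in> carrier_mat m m" "X \<in> so m"
  shows "M * X * M\<^sup>T \<in> (so m :: complex mat set)"
proof -
  have X: "X \<in> carrier_mat m m" "X\<^sup>T = - X" using assms(2) by (auto simp: so_def)
  have "(M * X * M\<^sup>T)\<^sup>T = M * X\<^sup>T * M\<^sup>T"
    using assms(1) X(1) by (simp add: transpose_mult[of _ m m _ m] assoc_mult_mat[of _ m m _ m _ m])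
  also have "\<dots> = - (M * X * M\<^sup>T)"
    using assms(1) X by simp
  finally show ?thesis using assms(1) X by (simp add: so_def)
qed

lemma root_coords_so: "X \<in> so (2 * n) \<Longrightarrow> root_coords n X \<in> so (2 * n)"
  unfolding root_coords_def by (rule congruence_skew) auto

lemma from_root_coords_so: "X \<in> so (2 * n) \<Longrightarrow> from_root_coords n X \<in> so (2 * n)"
  unfolding from_root_coords_def by (rule congruence_skew) auto

lemma so_entry_skew:
  assumes "X \<in> so m" "k < m" "l < m"
  shows "X $$ (l, k) = - X $$ (k, l)"
proof -
  have X: "X \<in> carrier_mat m m" "X\<^sup>T = - X" using assms(1) by (auto simp: so_def)
  have "X $$ (l, k) = X\<^sup>T $$ (k, l)" using X(1) assms(2,3) by simp
  also have "\<dots> = - X $$ (k, l)" unfolding X(2) using X(1) assms(2,3) by simp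
  finally show ?thesis .
qed

lemma soI:
  assumes "X \<in> carrier_mat m m" "\<And>k l. k < m \<Longrightarrow> l < m \<Longrightarrow> X $$ (l, k) = - X $$ (k, l)"
  shows "X \<in> so m"
proof -
  have "X\<^sup>T = - X"
  proof (rule eq_matI)
    fix k l assume "k < dim_row (- X)" "l < dim_col (- X)"
    then have "k < m" "l < m" using assms(1) by auto
    then show "X\<^sup>T $$ (k, l) = (- X) $$ (k, l)"
      using assms(1) assms(2)[of k l] by simp
  qed (use assms(1) in auto)
  then show ?thesis using assms(1) by (simp add: so_def)
qed

lemma so_diagonal: "X \<in> so m \<Longrightarrow> k < m \<Longrightarrow> X $$ (k, k) = (0 :: complex)"
  using eq_neg_iff_add_eq_0[THEN iffD1, OF so_entry_skew[of X m k k]] by (simp flip: mult_2)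

lemma toral_e_basis:
  "map_mat complex_of_real (toral n a) * e_basis n =
     e_basis n * mat (2 * n) (2 * n) (\<lambda>(k, l). if k = l then \<i> * of_real (weight n a k) else 0)"
  (is "?A * ?U = ?U * ?D")
proof (rule eq_matI)
  fix r k assume "r < dim_row (?U * ?D)" "k < dim_col (?U * ?D)"
  then have rk: "r < 2 * n" "k < 2 * n" by (auto simp: e_basis_def)
  have "(?A * ?U) $$ (r, k) = (\<Sum>c<2*n. complex_of_real (toral n a $$ (r, c)) * e_vec n (Suc k) $ c)"
    using rk by (simp add: e_basis_def scalar_prod_def atLeast0LessThan carrier_matD[OF toral_carrier])
  also have "\<dots> = (\<Sum>c<2*n. (if c = r - n then if n \<le> r then complex_of_real (a (Suc c)) * e_vec n (Suc k) $ c else 0 else 0)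
     + (if c = n + r then - of_real (a (Suc r)) * e_vec n (Suc k) $ c else 0))"
    using rk by (intro sum.cong refl) (auto simp: toral_entry)
  also have "\<dots> = \<i> * of_real (weight n a k) * e_vec n (Suc k) $ r"
  proof -
    have ii: "\<i> * x * \<i> = - x" for x by (simp add: complex_eq_iff)
    show ?thesis using rk by (auto simp: sum.distrib weight_def e_vec_def Suc_diff_le ii)
  qed
  also have "\<dots> = (\<Sum>c<2*n. e_vec n (Suc c) $ r * (if c = k then \<i> * of_real (weight n a c) else 0))"
  proof -
    have "e_vec n (Suc c) $ r * (if c = k then \<i> * of_real (weight n a c) else 0)
      = (if c = k then e_vec n (Suc k) $ r * (\<i> * of_real (weight n a k)) else 0)" for c by simp
    then show ?thesis using rk by simp
  qed
  also have "\<dots> = (?U * ?D) $$ (r, k)"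
    using rk by (simp add: e_basis_def scalar_prod_def atLeast0LessThan)
  finally show "(?A * ?U) $$ (r, k) = (?U * ?D) $$ (r, k)" .
qed (auto simp: e_basis_def carrier_matD[OF toral_carrier])

text \<open>
A torus element \<open>A\<close> is skew, hence \<open>ad A X = A X + X A\<^sup>T\<close> is the derivation of the tensor square
induced by \<open>A\<close>.  In the basis \<open>e_k e_l\<^sup>T\<close> it is diagonal and weights add up.
\<close>

lemma root_coords_ad:
  assumes X: "X \<in> carrier_mat (2 * n) (2 * n)" and kl: "k < 2 * n" "l < 2 * n"
  shows "root_coords n (ad (toral n a) X) $$ (k, l) =
    \<i> * of_real (weight n a k + weight n a l) * root_coords n X $$ (k, l)"
proof -
  let ?m = "2 * n"
  define A where "A = map_mat complex_of_real (toral n a)"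
  define D where "D = mat ?m ?m (\<lambda>(k, l). if k = l then \<i> * complex_of_real (weight n a k) else 0)"
  define W where "W = e_dual n"
  define U where "U = e_basis n"
  have c [simp]: "A \<in> carrier_mat ?m ?m" "D \<in> carrier_mat ?m ?m" "W \<in> carrier_mat ?m ?m"
    "U \<in> carrier_mat ?m ?m" "W\<^sup>T \<in> carrier_mat ?m ?m" "X \<in> carrier_mat ?m ?m"
    using X by (auto simp: A_def D_def W_def U_def)
  note ac = assoc_mult_mat[of _ ?m ?m _ ?m _ ?m] mult_carrier_mat[of _ ?m ?m _ ?m]
  have AT: "A\<^sup>T = - A"
    by (rule eq_matI) (auto simp: A_def toral_entry carrier_matD[OF toral_carrier])
  have WA: "W * A = D * W"
  proof -
    have "A * (U * W) = A" unfolding U_def W_def e_basis_e_dual by (rule right_mult_one_mat[OF c(1)])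
    then have "W * A = W * (A * (U * W))" by simp
    also have "\<dots> = W * ((A * U) * W)" by (simp add: ac)
    also have "A * U = U * D" unfolding A_def U_def D_def by (rule toral_e_basis)
    also have "W * (U * D * W) = (W * U) * (D * W)" by (simp add: ac)
    also have "W * U = 1\<^sub>m ?m" unfolding U_def W_def by (rule e_dual_e_basis)
    finally show ?thesis by (simp add: left_mult_one_mat[of _ ?m ?m] mult_carrier_mat[of _ ?m ?m _ ?m])
  qed
  have AW: "A * W\<^sup>T = - (W\<^sup>T * D)"
  proof -
    have "D\<^sup>T = D" by (rule eq_matI) (auto simp: D_def)
    then have "W\<^sup>T * D = (D * W)\<^sup>T" by (simp add: transpose_mult[of _ ?m ?m _ ?m])
    also have "\<dots> = A\<^sup>T * W\<^sup>T" by (simp add: transpose_mult[of _ ?m ?m _ ?m] flip: WA)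
    also have "\<dots> = - (A * W\<^sup>T)"
      unfolding AT by (rule uminus_mult_left_mat) (simp add: carrier_matD[OF c(1)] carrier_matD[OF c(3)])
    finally show ?thesis by simp
  qed
  define Y where "Y = W * X * W\<^sup>T"
  have Yc [simp]: "Y \<in> carrier_mat ?m ?m" by (simp add: Y_def ac)
  have "W * (A * X - X * A) * W\<^sup>T = W * (A * X) * W\<^sup>T - W * (X * A) * W\<^sup>T"
    by (simp add: mult_minus_distrib_mat[of _ ?m ?m _ ?m] minus_mult_distrib_mat[of _ ?m ?m _ _ ?m] ac)
  also have "W * (A * X) * W\<^sup>T = (W * A) * X * W\<^sup>T" by (simp add: ac)
  also have "\<dots> = D * Y" unfolding WA by (simp add: ac Y_def)
  also have "W * (X * A) * W\<^sup>T = W * X * (A * W\<^sup>T)" by (simp add: ac)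
  also have "\<dots> = - (Y * D)" unfolding AW by (simp add: ac Y_def c[THEN carrier_matD(1)] c[THEN carrier_matD(2)])
  finally have "root_coords n (ad (toral n a) X) = D * Y - (- (Y * D))"
    by (simp add: root_coords_def ad_def A_def W_def)
  then have "root_coords n (ad (toral n a) X) $$ (k, l) = (D * Y) $$ (k, l) + (Y * D) $$ (k, l)"
    using kl by (simp add: carrier_matD[OF Yc] carrier_matD[OF c(2)])
  \<comment> \<open>The products with \<open>D\<close> scale the rows and the columns of \<open>Y\<close> by the eigenvalues.\<close>
  also have "(D * Y) $$ (k, l) = (\<Sum>r<?m. D $$ (k, r) * Y $$ (r, l))"
    using kl by (simp add: carrier_matD[OF Yc] carrier_matD[OF c(2)] scalar_prod_def atLeast0LessThan)
  also have "\<dots> = (\<Sum>r<?m. if r = k then \<i> * complex_of_real (weight n a k) * Y $$ (k, l) else 0)"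
    using kl by (intro sum.cong) (auto simp: D_def)
  also have "(Y * D) $$ (k, l) = (\<Sum>r<?m. Y $$ (k, r) * D $$ (r, l))"
    using kl by (simp add: carrier_matD[OF Yc] carrier_matD[OF c(2)] scalar_prod_def atLeast0LessThan)
  also have "\<dots> = (\<Sum>r<?m. if r = l then \<i> * complex_of_real (weight n a l) * Y $$ (k, l) else 0)"
    using kl by (intro sum.cong) (auto simp: D_def)
  finally show ?thesis
    using kl by (simp add: Y_def W_def root_coords_def algebra_simps)
qed

lemma root_coords_smult:
  assumes "X \<in> carrier_mat (2 * n) (2 * n)" "k < 2 * n" "l < 2 * n"
  shows "root_coords n (c \<cdot>\<^sub>m X) $$ (k, l) = c * root_coords n X $$ (k, l)"
  unfolding root_coords_def congruence_entry[OF e_dual_carrier smult_carrier_mat[OF assms(1)] assms(2,3)]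
    congruence_entry[OF e_dual_carrier assms] sum_distrib_left
  using assms by (intro sum.cong refl) auto

lemma root_coords_sum:
  assumes "k < 2 * n" "l < 2 * n" "\<And>j. j \<in> J \<Longrightarrow> X j \<in> carrier_mat (2 * n) (2 * n)"
  shows "root_coords n (sum_matrices (2 * n) X J) $$ (k, l) = (\<Sum>j\<in>J. root_coords n (X j) $$ (k, l))"
proof -
  have "(\<Sum>j\<in>J. root_coords n (X j) $$ (k, l))
    = (\<Sum>j\<in>J. \<Sum>r<2*n. \<Sum>s<2*n. e_dual n $$ (k, r) * X j $$ (r, s) * e_dual n $$ (l, s))"
    unfolding root_coords_def using assms by (intro sum.cong refl congruence_entry) auto
  also have "\<dots> = (\<Sum>r<2*n. \<Sum>j\<in>J. \<Sum>s<2*n. e_dual n $$ (k, r) * X j $$ (r, s) * e_dual n $$ (l, s))"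
    by (rule sum.swap)
  also have "\<dots> = (\<Sum>r<2*n. \<Sum>s<2*n. \<Sum>j\<in>J. e_dual n $$ (k, r) * X j $$ (r, s) * e_dual n $$ (l, s))"
    by (intro sum.cong refl sum.swap)
  also have "\<dots> = root_coords n (sum_matrices (2 * n) X J) $$ (k, l)"
    unfolding root_coords_def using assms(1,2)
    by (subst congruence_entry[of _ "2 * n"])
      (auto simp: sum_matrices_def sum_distrib_left sum_distrib_right intro!: sum.cong)
  finally show ?thesis by simp
qed

lemma g_eigenspace_toral:
  "g_eigenspace n (toral n a) j = {X \<in> so (2 * n). \<forall>k<2*n. \<forall>l<2*n.
     root_coords n X $$ (k, l) \<noteq> 0 \<longrightarrow> weight n a k + weight n a l = of_int j}"
proof -
  have "ad (toral n a) X = (\<i> * of_int j) \<cdot>\<^sub>m X \<longleftrightarrow> (\<forall>k<2*n. \<forall>l<2*n.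
     root_coords n X $$ (k, l) \<noteq> 0 \<longrightarrow> weight n a k + weight n a l = of_int j)"
    if "X \<in> so (2 * n)" for X
  proof -
    have X: "X \<in> carrier_mat (2 * n) (2 * n)" using that by (simp add: so_def)
    then have adX: "ad (toral n a) X \<in> carrier_mat (2 * n) (2 * n)"
      by (intro carrier_matI) (simp_all add: ad_def carrier_matD[OF toral_carrier])
    have "ad (toral n a) X = (\<i> * of_int j) \<cdot>\<^sub>m X \<longleftrightarrow> (\<forall>k<2*n. \<forall>l<2*n.
      root_coords n (ad (toral n a) X) $$ (k, l) = root_coords n ((\<i> * of_int j) \<cdot>\<^sub>m X) $$ (k, l))"
      using root_coords_eqI[OF adX smult_carrier_mat[OF X]] by metis
    also have "\<dots> \<longleftrightarrow> (\<forall>k<2*n. \<forall>l<2*n. of_real (weight n a k + weight n a l) * root_coords n X $$ (k, l)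
        = complex_of_real (of_int j) * root_coords n X $$ (k, l))"
      by (simp add: root_coords_ad[OF X] root_coords_smult[OF X] mult.assoc cong: imp_cong)
    also have "\<dots> \<longleftrightarrow> (\<forall>k<2*n. \<forall>l<2*n.
     root_coords n X $$ (k, l) \<noteq> 0 \<longrightarrow> weight n a k + weight n a l = of_int j)"
      unfolding mult_cancel_right of_real_eq_iff by blast
    finally show ?thesis .
  qed
  then show ?thesis unfolding g_eigenspace_def by blast
qed

lemma weight_integral:
  assumes "\<forall>i\<in>{1..n}. a i \<in> \<int>" "k < 2 * n"
  shows "weight n a k \<in> \<int>"
proof -
  have "Suc k \<in> {1..n}" if "k < n" using that by simp
  moreover have "Suc k - n \<in> {1..n}" if "\<not> k < n" using that assms(2) by auto
  ultimately show ?thesis using assms(1) unfolding weight_def by (metis Ints_minus)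
qed

text \<open>
The integrality of the weights matters for the inclusion from right to left: a matrix
is split into the parts with a common value of the weight sum, and this value has to be an
integer for the part to lie in one of the eigenspaces that make up the filtration.
\<close>

lemma p_filtration_toral:
  assumes int: "\<forall>i\<in>{1..n}. a i \<in> \<int>"
  shows "p_filtration n (toral n a) i = {X \<in> so (2 * n). \<forall>k<2*n. \<forall>l<2*n.
     root_coords n X $$ (k, l) \<noteq> 0 \<longrightarrow> weight n a k + weight n a l \<le> of_int i}" (is "_ = ?R")
proof (intro equalityI subsetI)
  fix X assume "X \<in> p_filtration n (toral n a) i"
  then obtain F J where X: "X = sum_matrices (2 * n) F J" and J: "finite J" "J \<subseteq> {..i}"
    and F: "\<forall>j\<in>J. F j \<in> g_eigenspace n (toral n a) j"
    unfolding p_filtration_def by blast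
  have so: "F j \<in> so (2 * n)" if "j \<in> J" for j using F that by (auto simp: g_eigenspace_def)
  have "X \<in> so (2 * n)"
  proof (rule soI)
    fix k l assume kl: "k < 2 * n" "l < 2 * n"
    show "X $$ (l, k) = - X $$ (k, l)"
      using so_entry_skew[OF so kl] kl by (simp add: X sum_matrices_def sum_negf)
  qed (simp add: X)
  moreover have "weight n a k + weight n a l \<le> of_int i"
    if "k < 2 * n" "l < 2 * n" "root_coords n X $$ (k, l) \<noteq> 0" for k l
  proof -
    have "(\<Sum>j\<in>J. root_coords n (F j) $$ (k, l)) \<noteq> 0"
      using root_coords_sum[of k n l J F] that so by (auto simp: X so_def)
    then obtain j where j: "j \<in> J" "root_coords n (F j) $$ (k, l) \<noteq> 0"
      by (meson sum.neutral)
    then have "weight n a k + weight n a l = of_int j"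
      using F that unfolding g_eigenspace_toral by blast
    then show ?thesis using j J by auto
  qed
  ultimately show "X \<in> ?R" by blast
next
  fix X assume "X \<in> ?R"
  then have X: "X \<in> so (2 * n)" and
    le: "\<And>k l. k < 2 * n \<Longrightarrow> l < 2 * n \<Longrightarrow> root_coords n X $$ (k, l) \<noteq> 0 \<Longrightarrow> weight n a k + weight n a l \<le> of_int i"
    by auto
  define h where "h k l = \<lfloor>weight n a k + weight n a l\<rfloor>" for k l
  have h: "weight n a k + weight n a l = of_int (h k l)" if "k < 2 * n" "l < 2 * n" for k l
    using weight_integral[OF int] that unfolding h_def by (metis Ints_add Ints_cases floor_of_int)
  have hsym: "h k l = h l k" for k l by (simp add: h_def add.commute)
  define J where "J = (\<lambda>(k, l). h k l) ` ({..<2*n} \<times> {..<2*n}) \<inter> {..i}"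
  define G where "G j = mat (2 * n) (2 * n) (\<lambda>(k, l). if h k l = j then root_coords n X $$ (k, l) else 0)" for j
  define F where "F j = from_root_coords n (G j)" for j
  have G: "G j \<in> so (2 * n)" for j
  proof (rule soI)
    fix k l assume kl: "k < 2 * n" "l < 2 * n"
    show "G j $$ (l, k) = - G j $$ (k, l)"
      using so_entry_skew[OF root_coords_so[OF X] kl] hsym[of k l] kl by (simp add: G_def)
  qed (simp add: G_def)
  have rF: "root_coords n (F j) = G j" for j
    unfolding F_def by (rule root_coords_inverse) (simp add: G_def)
  have Fc: "F j \<in> carrier_mat (2 * n) (2 * n)" for j by (simp add: F_def)
  have "F j \<in> g_eigenspace n (toral n a) j" for j
    unfolding g_eigenspace_toral using from_root_coords_so[OF G] h rF
    by (auto simp: F_def G_def split: if_splits)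
  moreover have "X = sum_matrices (2 * n) F J"
  proof (rule root_coords_eqI)
    fix k l assume kl: "k < 2 * n" "l < 2 * n"
    have "root_coords n (sum_matrices (2 * n) F J) $$ (k, l) = (\<Sum>j\<in>J. G j $$ (k, l))"
      using kl Fc by (simp add: root_coords_sum rF)
    also have "\<dots> = (\<Sum>j\<in>J. if j = h k l then root_coords n X $$ (k, l) else 0)"
      using kl by (intro sum.cong) (auto simp: G_def)
    also have "\<dots> = (if h k l \<in> J then root_coords n X $$ (k, l) else 0)"
      by (simp add: J_def)
    also have "\<dots> = root_coords n X $$ (k, l)"
      using le[OF kl] h[OF kl] kl by (auto simp: J_def)
    finally show "root_coords n X $$ (k, l) = root_coords n (sum_matrices (2 * n) F J) $$ (k, l)" ..
  qed (use X in \<open>auto simp: so_def\<close>)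
  moreover have "finite J" "J \<subseteq> {..i}" by (auto simp: J_def)
  ultimately show "X \<in> p_filtration n (toral n a) i" unfolding p_filtration_def by blast
qed

text \<open>
The root vectors \<open>e_k \<and> e_l\<close> with \<open>k \<noteq> l\<close> test the inclusion; the diagonal pairs are excluded since
the diagonal coefficients of a skew matrix vanish.
\<close>

lemma p_filtration_toral_subset_iff:
  assumes int: "\<forall>i\<in>{1..n}. a i \<in> \<int>" "\<forall>i\<in>{1..n}. b i \<in> \<int>"
  shows "p_filtration n (toral n a) i \<subseteq> p_filtration n (toral n b) i \<longleftrightarrow>
    (\<forall>k<2*n. \<forall>l<2*n. k \<noteq> l \<longrightarrow> weight n a k + weight n a l \<le> of_int i \<longrightarrow>
       weight n b k + weight n b l \<le> of_int i)" (is "?L \<longleftrightarrow> ?R")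
proof
  assume L: ?L
  show ?R
  proof (intro allI impI)
    fix k l assume kl: "k < 2 * n" "l < 2 * n" "k \<noteq> l" and le: "weight n a k + weight n a l \<le> of_int i"
    define Y where "Y = mat (2 * n) (2 * n) (\<lambda>(r, s). if r = k \<and> s = l then 1
      else if r = l \<and> s = k then -1 else (0 :: complex))"
    have Y: "Y \<in> so (2 * n)" using kl by (intro soI) (auto simp: Y_def)
    then have rY: "root_coords n (from_root_coords n Y) = Y"
      by (intro root_coords_inverse) (simp add: so_def)
    have "from_root_coords n Y \<in> p_filtration n (toral n a) i"
      unfolding p_filtration_toral[OF int(1)] using from_root_coords_so[OF Y] le kl
      by (auto simp: rY) (auto simp: Y_def split: if_splits)
    then have "from_root_coords n Y \<in> p_filtration n (toral n b) i" using L by blast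
    moreover have "Y $$ (k, l) \<noteq> 0" using kl by (simp add: Y_def)
    ultimately show "weight n b k + weight n b l \<le> of_int i"
      unfolding p_filtration_toral[OF int(2)] using kl rY by auto
  qed
next
  assume ?R
  then show ?L
    unfolding p_filtration_toral[OF int(1)] p_filtration_toral[OF int(2)]
    using so_diagonal[OF root_coords_so] by blast
qed

section \<open>Coordinates with respect to the dual basis of the simple roots\<close>

text \<open>
Coefficient of \<open>E_i\<close> in \<open>H_j\<close>.
\<close>

definition H_coord :: "nat \<Rightarrow> nat \<Rightarrow> nat \<Rightarrow> real" where
  "H_coord n j i = (if j \<le> n - 2 then of_bool (i \<le> j) else if i < n \<or> j = n then 1 / 2 else - 1 / 2)"

definition H_comb :: "nat \<Rightarrow> (nat \<Rightarrow> real) \<Rightarrow> real mat" where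
  "H_comb n c = sum_matrices (2 * n) (\<lambda>i. c i \<cdot>\<^sub>m H n i) {1..n}"

text \<open>
Coefficient of \<open>E_i\<close> in \<open>\<Sum> c_j H_j\<close>.
\<close>

definition E_coord :: "nat \<Rightarrow> (nat \<Rightarrow> real) \<Rightarrow> nat \<Rightarrow> real" where
  "E_coord n c i = (\<Sum>j=1..n. c j * H_coord n j i)"

lemma H_comb_carrier [simp, intro]: "H_comb n c \<in> carrier_mat (2 * n) (2 * n)"
  by (simp add: H_comb_def)

lemma H_comb_entry:
  "r < 2 * n \<Longrightarrow> s < 2 * n \<Longrightarrow> H_comb n c $$ (r, s) = (\<Sum>i=1..n. c i * H n i $$ (r, s))"
  by (simp add: H_comb_def sum_matrices_def carrier_matD[OF H_carrier])

lemma toral_arith: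
  "toral n a + toral n b = toral n (\<lambda>i. a i + b i)"
  "toral n a - toral n b = toral n (\<lambda>i. a i - b i)"
  by (rule eq_matI; auto simp: toral_entry carrier_matD[OF toral_carrier])+

lemma sum_E_eq_toral:
  assumes "J \<subseteq> {1..n}"
  shows "sum_matrices (2 * n) (E n) J = toral n (\<lambda>i. of_bool (i \<in> J))"
proof -
  have "(\<Sum>i\<in>J. E n i $$ (r, c)) = (\<Sum>i\<in>{1..n}. of_bool (i \<in> J) * E n i $$ (r, c))" for r c
    using assms by (intro sum.mono_neutral_cong_left) auto
  then show ?thesis
    unfolding toral_def sum_matrices_def
    by (intro eq_matI) (auto simp: carrier_matD[OF E_carrier])
qed

lemma H_eq_toral:
  assumes "n \<ge> 2" "j \<in> {1..n}"
  shows "H n j = toral n (H_coord n j)"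
proof -
  have "sum_matrices (2 * n) (E n) {n} = E n n"
    by (rule eq_matI) (auto simp: sum_matrices_def carrier_matD[OF E_carrier])
  then have En: "E n n = toral n (\<lambda>i. of_bool (i = n))"
    using sum_E_eq_toral[of "{n}" n] assms(1) by simp
  show ?thesis
    unfolding H_def En using assms
    by (auto simp: sum_E_eq_toral toral_arith smult_toral H_coord_def intro!: toral_cong)
qed

lemma H_comb_eq_toral:
  assumes "n \<ge> 2"
  shows "H_comb n c = toral n (E_coord n c)"
proof (rule eq_matI)
  fix r s assume "r < dim_row (toral n (E_coord n c))" "s < dim_col (toral n (E_coord n c))"
  then have rs: "r < 2 * n" "s < 2 * n" by (auto simp: carrier_matD[OF toral_carrier])
  have "H_comb n c $$ (r, s) = (\<Sum>i=1..n. c i * toral n (H_coord n i) $$ (r, s))"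
    unfolding H_comb_entry[OF rs] using H_eq_toral[OF assms] by (intro sum.cong) auto
  also have "\<dots> = toral n (E_coord n c) $$ (r, s)"
    by (simp add: toral_entry[OF rs] E_coord_def sum_negf)
  finally show "H_comb n c $$ (r, s) = toral n (E_coord n c) $$ (r, s)" .
qed (auto simp: carrier_matD[OF toral_carrier] carrier_matD[OF H_comb_carrier])

text \<open>
Together with \<open>E_coord_last\<close> this expresses that the \<open>H_j\<close> are dual to the simple roots.
\<close>

lemma E_coord_diff:
  assumes "n \<ge> 3" "i \<in> {1..<n}"
  shows "E_coord n c i - E_coord n c (Suc i) = c i"
proof -
  have "E_coord n c i - E_coord n c (Suc i) = (\<Sum>j=1..n. if j = i then c j else 0)"
    unfolding E_coord_def sum_subtractf[symmetric] right_diff_distrib[symmetric]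
    using assms by (intro sum.cong refl) (auto simp: H_coord_def)
  then show ?thesis using assms by simp
qed

lemma E_coord_last:
  assumes "n \<ge> 3"
  shows "E_coord n c (n - 1) + E_coord n c n = c n"
proof -
  have "E_coord n c (n - 1) + E_coord n c n = (\<Sum>j=1..n. if j = n then c j else 0)"
    unfolding E_coord_def sum.distrib[symmetric] distrib_left[symmetric]
    using assms by (intro sum.cong refl) (auto simp: H_coord_def)
  then show ?thesis using assms by simp
qed

lemma E_coord_n: "n \<ge> 3 \<Longrightarrow> E_coord n c n = (c n - c (n - 1)) / 2"
  using E_coord_diff[of n "n - 1" c] E_coord_last[of n c] by (simp add: le_diff_conv2)

lemma E_coord_minus: "E_coord n (\<lambda>i. c i - c' i) i = E_coord n c i - E_coord n c' i"
  by (simp add: E_coord_def left_diff_distrib sum_subtractf)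

lemma sum_split_last2:
  fixes f :: "nat \<Rightarrow> 'a::comm_monoid_add"
  assumes "n \<ge> 3"
  shows "(\<Sum>j=1..n. f j) = (\<Sum>j=1..n-2. f j) + f (n - 1) + f n"
proof -
  obtain m where "n = Suc (Suc m)" using assms by (metis add_2_eq_Suc le_Suc_ex numeral_3_eq_3 add_Suc)
  then show ?thesis by simp
qed

lemma sum_E_coord:
  assumes "n \<ge> 3"
  shows "(\<Sum>i=1..n. E_coord n c i) =
    (\<Sum>j=1..n-2. real j * c j) + (real n - 2) / 2 * c (n - 1) + real n / 2 * c n"
proof -
  have h: "(\<Sum>i=1..n. H_coord n j i) = (if j \<le> n - 2 then real j else if j = n then real n / 2 else (real n - 2) / 2)"
    if "j \<in> {1..n}" for j
  proof (cases "j \<le> n - 2")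
    case True
    have "(\<Sum>i=1..n. H_coord n j i) = (\<Sum>i\<in>{1..j}. 1)"
      using True by (intro sum.mono_neutral_cong_right) (auto simp: H_coord_def)
    then show ?thesis using True by simp
  next
    case False
    have "(\<Sum>i=1..n-2. H_coord n j i) = (\<Sum>i=1..n-2. 1 / 2)"
      using False by (intro sum.cong refl) (auto simp: H_coord_def)
    then show ?thesis
      using False assms that unfolding sum_split_last2[OF assms]
      by (auto simp: H_coord_def of_nat_diff field_simps)
  qed
  have "(\<Sum>i=1..n. E_coord n c i) = (\<Sum>j=1..n. c j * (\<Sum>i=1..n. H_coord n j i))"
    unfolding E_coord_def sum_distrib_left by (rule sum.swap)
  also have "\<dots> = (\<Sum>j=1..n-2. c j * (\<Sum>i=1..n. H_coord n j i))
      + c (n - 1) * (\<Sum>i=1..n. H_coord n (n - 1) i) + c n * (\<Sum>i=1..n. H_coord n n i)"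
    by (rule sum_split_last2[OF assms])
  also have "(\<Sum>j=1..n-2. c j * (\<Sum>i=1..n. H_coord n j i)) = (\<Sum>j=1..n-2. real j * c j)"
    using h by (intro sum.cong refl) (auto simp: mult.commute)
  finally show ?thesis using assms h[of n] h[of "n - 1"] by (auto simp: mult.commute)
qed

lemma E_coord_antimono:
  assumes n: "n \<ge> 3" and c: "\<forall>i\<in>{1..n}. c i \<ge> 0" and ij: "1 \<le> i" "i \<le> j" "j \<le> n"
  shows "E_coord n c j \<le> E_coord n c i"
  using ij(2,3)
proof (induction j rule: dec_induct)
  case (step m)
  then have "E_coord n c m - E_coord n c (Suc m) = c m" "c m \<ge> 0" "E_coord n c m \<le> E_coord n c i"
    using E_coord_diff[OF n, of m c] c ij(1) by auto
  then show ?case by linarith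
qed simp

lemma E_coord_add_nonneg:
  assumes n: "n \<ge> 3" and c: "\<forall>i\<in>{1..n}. c i \<ge> 0" and ij: "1 \<le> i" "i < j" "j \<le> n"
  shows "0 \<le> E_coord n c i + E_coord n c j"
proof -
  have "E_coord n c (n - 1) \<le> E_coord n c i" "E_coord n c n \<le> E_coord n c j"
    using ij n by (auto intro!: E_coord_antimono[OF n c])
  moreover have "c n \<ge> 0" using c n by auto
  ultimately show ?thesis using E_coord_last[OF n, of c] by linarith
qed

text \<open>
Every root is positive or negative, uniformly on the closed dominant chamber.  The pair \<open>k, l\<close> gives
\<open>L_i + L_j\<close>, \<open>L_i - L_j\<close>, zero or the opposite of such a root, depending on which of \<open>k\<close> and \<open>l\<close> are
below \<open>n\<close>.
\<close>

lemma weight_sum_sign: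
  assumes n: "n \<ge> 3" and kl: "k < 2 * n" "l < 2 * n" "k \<noteq> l"
  shows "(\<forall>c. (\<forall>i\<in>{1..n}. c i \<ge> 0) \<longrightarrow> 0 \<le> weight n (E_coord n c) k + weight n (E_coord n c) l)
       \<or> (\<forall>c. (\<forall>i\<in>{1..n}. c i \<ge> 0) \<longrightarrow> weight n (E_coord n c) k + weight n (E_coord n c) l \<le> 0)"
  using kl
proof (induction k l rule: linorder_wlog)
  case (le k l)
  consider "l < n" | "k < n" "n \<le> l" "k \<le> l - n" | "k < n" "n \<le> l" "l - n \<le> k" | "n \<le> k" by linarith
  then show ?case
  proof cases
    case 1
    then show ?thesis using le E_coord_add_nonneg[OF n, of _ "Suc k" "Suc l"] by (auto simp: weight_def)
  next
    case 2
    then show ?thesis using le E_coord_antimono[OF n, of _ "Suc k" "Suc l - n"]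
      by (auto simp: weight_def)
  next
    case 3
    then show ?thesis using le E_coord_antimono[OF n, of _ "Suc l - n" "Suc k"]
      by (auto simp: weight_def)
  next
    case 4
    have "weight n (E_coord n c) k + weight n (E_coord n c) l \<le> 0" if c: "\<forall>i\<in>{1..n}. c i \<ge> 0" for c
    proof -
      have "1 \<le> Suc k - n" "Suc k - n < Suc l - n" "Suc l - n \<le> n" using 4 le by auto
      from E_coord_add_nonneg[OF n c this] show ?thesis using 4 le by (simp add: weight_def)
    qed
    then show ?thesis by blast
  qed
next
  case (sym k l)
  then show ?case by (simp add: add.commute)
qed

lemma weight_E_coord_minus:
  "weight n (E_coord n (\<lambda>i. c i - c' i)) k = weight n (E_coord n c) k - weight n (E_coord n c') k"
  by (simp add: weight_def E_coord_minus)

lemma coeff_Ints: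
  assumes n: "n \<ge> 3" and int: "\<forall>i\<in>{1..n}. E_coord n c i \<in> \<int>" and i: "i \<in> {1..n}"
  shows "c i \<in> \<int>"
proof (cases "i < n")
  case True
  then have "c i = E_coord n c i - E_coord n c (Suc i)" using E_coord_diff[OF n, of i c] i by auto
  moreover have "E_coord n c i \<in> \<int>" "E_coord n c (Suc i) \<in> \<int>"
    using True i int[rule_format, of i] int[rule_format, of "Suc i"] by auto
  ultimately show ?thesis by simp
next
  case False
  then have "c i = E_coord n c (n - 1) + E_coord n c n" using E_coord_last[OF n, of c] i by auto
  moreover have "E_coord n c (n - 1) \<in> \<int>" "E_coord n c n \<in> \<int>"
    using n int[rule_format, of "n - 1"] int[rule_format, of n] by auto
  ultimately show ?thesis by simp
qed

text \<open>
From left to right, the root vector of the simple root \<open>\<alpha>_i\<close> lies in the step \<open>c_i\<close> of the first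
filtration, hence in that step of the second one.  From right to left, a
positive root is monotone in the coefficients, being nonnegative on the dominant difference
\<open>c - c'\<close>; a negative root has nonpositive values and is never an obstruction, as only the steps
\<open>i \<ge> 0\<close> are compared.
\<close>

lemma canonical_le_H_comb_iff:
  assumes n: "n \<ge> 3"
    and int: "\<forall>i\<in>{1..n}. E_coord n c i \<in> \<int>" "\<forall>i\<in>{1..n}. E_coord n c' i \<in> \<int>"
    and pos: "\<forall>i\<in>{1..n}. c i \<ge> 0" "\<forall>i\<in>{1..n}. c' i \<ge> 0"
  shows "canonical_le n (H_comb n c) (H_comb n c') \<longleftrightarrow> (\<forall>i\<in>{1..n}. c' i \<le> c i)"
proof -
  let ?w = "weight n (E_coord n c)" and ?w' = "weight n (E_coord n c')"
  have n2: "n \<ge> 2" using n by simp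
  have iff: "canonical_le n (H_comb n c) (H_comb n c') \<longleftrightarrow> (\<forall>i\<ge>0. \<forall>k<2*n. \<forall>l<2*n. k \<noteq> l \<longrightarrow>
      ?w k + ?w l \<le> of_int i \<longrightarrow> ?w' k + ?w' l \<le> of_int i)"
    unfolding canonical_le_def H_comb_eq_toral[OF n2] p_filtration_toral_subset_iff[OF int] ..
  show ?thesis
  proof
    assume L: "canonical_le n (H_comb n c) (H_comb n c')"
    show "\<forall>i\<in>{1..n}. c' i \<le> c i"
    proof
      fix i assume i: "i \<in> {1..n}"
      obtain z where z: "c i = of_int z" using coeff_Ints[OF n int(1) i] by (auto elim: Ints_cases)
      then have z0: "z \<ge> 0" using pos i by (metis of_int_0_le_iff)
      \<comment> \<open>The pair of weights whose sum is the simple root \<open>\<alpha>_i\<close>.\<close>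
      have "\<exists>k l. k < 2 * n \<and> l < 2 * n \<and> k \<noteq> l \<and>
         (\<forall>c. weight n (E_coord n c) k + weight n (E_coord n c) l = c i)"
      proof (cases "i < n")
        case True
        then have "weight n (E_coord n c) (i - 1) + weight n (E_coord n c) (n + i) = c i" for c
          using i E_coord_diff[OF n, of i c] by (auto simp: weight_def)
        then show ?thesis using True i by (intro exI[of _ "i - 1"] exI[of _ "n + i"]) auto
      next
        case False
        then have "weight n (E_coord n c) (n - 2) + weight n (E_coord n c) (n - 1) = c i" for c
          using i n E_coord_last[OF n, of c] by (auto simp: weight_def Suc_diff_Suc numeral_2_eq_2)
        then show ?thesis using n by (intro exI[of _ "n - 2"] exI[of _ "n - 1"]) auto
      qed
      then obtain k l where kl: "k < 2 * n" "l < 2 * n" "k \<noteq> l"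
        and w: "\<And>c. weight n (E_coord n c) k + weight n (E_coord n c) l = c i" by blast
      then have "?w' k + ?w' l \<le> of_int z" 
        using L[unfolded iff, rule_format, OF z0 kl] w[of c] z by simp
      then show "c' i \<le> c i" using w z by simp
    qed
  next
    assume R: "\<forall>i\<in>{1..n}. c' i \<le> c i"
    show "canonical_le n (H_comb n c) (H_comb n c')"
      unfolding iff
    proof (intro allI impI)
      fix i :: int and k l :: nat
      assume i: "0 \<le> i" and kl: "k < 2 * n" "l < 2 * n" "k \<noteq> l" and le: "?w k + ?w l \<le> of_int i"
      from weight_sum_sign[OF n kl] show "?w' k + ?w' l \<le> of_int i"
      proof
        assume "\<forall>c. (\<forall>i\<in>{1..n}. c i \<ge> 0) \<longrightarrow> 0 \<le> weight n (E_coord n c) k + weight n (E_coord n c) l"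
        then have "0 \<le> weight n (E_coord n (\<lambda>i. c i - c' i)) k + weight n (E_coord n (\<lambda>i. c i - c' i)) l"
          using R by auto
        then show ?thesis using le by (simp add: weight_E_coord_minus)
      next
        assume "\<forall>c. (\<forall>i\<in>{1..n}. c i \<ge> 0) \<longrightarrow> weight n (E_coord n c) k + weight n (E_coord n c) l \<le> 0"
        then have "?w' k + ?w' l \<le> 0" using pos(2) by blast
        then show ?thesis using i by simp
      qed
    qed
  qed
qed

lemma Ints_quotient_iff:
  "real_of_int x / real_of_int k \<in> \<int> \<longleftrightarrow> k dvd x" if "k \<noteq> 0"
proof
  assume "real_of_int x / real_of_int k \<in> \<int>"
  then obtain q where "real_of_int x / real_of_int k = of_int q" by (auto elim: Ints_cases)
  then have "real_of_int x = of_int (k * q)" using that by (simp add: field_simps)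
  then show "k dvd x" by (simp only: of_int_eq_iff) simp
qed (use that in auto)

text \<open>
Consecutive \<open>E\<close>-coordinates differ by the integers \<open>c_i\<close>, so only the last one,
\<open>(c_n - c_(n-1)) / 2\<close>, decides.
\<close>

lemma E_coord_Ints_iff:
  assumes n: "n \<ge> 3"
  shows "(\<forall>i\<in>{1..n}. E_coord n (\<lambda>i. real (c i)) i \<in> \<int>) \<longleftrightarrow> even (c (n - 1) + c n)"
proof -
  let ?e = "E_coord n (\<lambda>i. real (c i))"
  have last: "?e n \<in> \<int> \<longleftrightarrow> even (c (n - 1) + c n)"
  proof -
    have e: "?e n = real_of_int (int (c n) - int (c (n - 1))) / of_int 2" by (simp add: E_coord_n[OF n])
    have "?e n \<in> \<int> \<longleftrightarrow> 2 dvd int (c n) - int (c (n - 1))"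
      unfolding e by (rule Ints_quotient_iff) simp
    then show ?thesis by presburger
  qed
  have "?e i \<in> \<int>" if "?e n \<in> \<int>" "i \<in> {1..n}" for i
  proof -
    have "i \<le> n" using that by simp
    then show ?thesis using that(2)
    proof (induction i rule: inc_induct)
      case (step i)
      have "?e i = real (c i) + ?e (Suc i)" using E_coord_diff[OF n, of i "\<lambda>i. real (c i)"] step by simp
      then show ?case using step by simp
    qed (use that in simp)
  qed
  then show ?thesis using last n by auto
qed

section \<open>Canonical elements as minimal solutions of a congruence\<close>

text \<open>
Integrality of \<open>\<Sum> c_i H_i\<close> in terms of \<open>S = \<Sum> i c_i\<close> over \<open>i \<le> n - 2\<close>, \<open>x = c_(n-1)\<close> and \<open>y = c_n\<close>.
\<close>

definition spin_cond :: "nat \<Rightarrow> nat \<Rightarrow> nat \<Rightarrow> nat \<Rightarrow> bool" where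
  "spin_cond n S x y \<longleftrightarrow>
     (if odd n then 4 dvd 2 * int S + int y - int x else even (x + y) \<and> even (S + x))"

text \<open>
Four times half the sum of the \<open>E\<close>-coordinates is \<open>2 S + (n - 2) x + n y\<close>.  Modulo 4 it can be reduced,
because the even number \<open>x + y\<close> occurs with the even factor \<open>n - 1\<close> or \<open>n\<close>.
\<close>

lemma spin_cond_iff:
  "spin_cond n S x y \<longleftrightarrow> even (x + y) \<and> 4 dvd 2 * int S + (int n - 2) * int x + int n * int y"
proof (cases "odd n")
  case True
  then obtain m where m: "n = 2 * m + 1" by (auto elim: oddE)
  have N: "2 * int S + (int n - 2) * int x + int n * int y
      = 2 * int S + int y - int x + 2 * int m * (int x + int y)"
    by (simp add: m algebra_simps)
  have "4 dvd 2 * int m * (int x + int y)" if "even (x + y)"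
  proof -
    from that obtain z where "x + y = 2 * z" by blast
    then have "int x + int y = 2 * int z" by linarith
    then show ?thesis by simp
  qed
  then have "4 dvd 2 * int S + int y - int x + 2 * int m * (int x + int y) \<longleftrightarrow> 4 dvd 2 * int S + int y - int x"
    if "even (x + y)" using that by (simp add: dvd_add_left_iff)
  moreover have "even (x + y)" if "4 dvd 2 * int S + int y - int x" using that by presburger
  ultimately show ?thesis using True unfolding spin_cond_def N by auto
next
  case False
  then obtain m where m: "n = 2 * m" by (auto elim: evenE)
  have N: "2 * int S + (int n - 2) * int x + int n * int y
      = 2 * int S - 2 * int x + 2 * int m * (int x + int y)"
    by (simp add: m algebra_simps)
  have "4 dvd 2 * int m * (int x + int y)" if "even (x + y)"
  proof -
    from that obtain z where "x + y = 2 * z" by blast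
    then have "int x + int y = 2 * int z" by linarith
    then show ?thesis by simp
  qed
  then have "4 dvd 2 * int S - 2 * int x + 2 * int m * (int x + int y) \<longleftrightarrow> 4 dvd 2 * int S - 2 * int x"
    if "even (x + y)" using that by (simp add: dvd_add_left_iff)
  moreover have "4 dvd 2 * int S - 2 * int x \<longleftrightarrow> even (S + x)" by presburger
  ultimately show ?thesis using False unfolding spin_cond_def N by auto
qed

lemma H_comb_nat_in_integral_lattice_iff:
  assumes n: "n \<ge> 3"
  shows "H_comb n (\<lambda>i. real (c i)) \<in> integral_lattice n \<longleftrightarrow>
    spin_cond n (\<Sum>i=1..n-2. i * c i) (c (n - 1)) (c n)"
proof -
  have n2: "n \<ge> 2" using n by simp
  define S where "S = (\<Sum>i=1..n-2. i * c i)"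
  have e: "(\<Sum>i=1..n. E_coord n (\<lambda>i. real (c i)) i) / 2 =
    real_of_int (2 * int S + (int n - 2) * int (c (n - 1)) + int n * int (c n)) / of_int 4"
    unfolding sum_E_coord[OF n] S_def by (simp add: field_simps)
  have "(\<Sum>i=1..n. E_coord n (\<lambda>i. real (c i)) i) / 2 \<in> \<int> \<longleftrightarrow>
    4 dvd 2 * int S + (int n - 2) * int (c (n - 1)) + int n * int (c n)"
    unfolding e by (rule Ints_quotient_iff) simp
  then show ?thesis
    unfolding H_comb_eq_toral[OF n2] toral_in_integral_lattice_iff E_coord_Ints_iff[OF n] spin_cond_iff S_def
    by simp
qed

lemma H_comb_in_dominant_lattice:
  assumes n: "n \<ge> 3" and c: "\<forall>i\<in>{1..n}. c i \<ge> 0" and lat: "H_comb n c \<in> integral_lattice n"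
  shows "H_comb n c \<in> dominant_lattice n"
proof -
  have n2: "n \<ge> 2" using n by simp
  have L: "L n i (H_comb n c) = \<i> * of_real (E_coord n c i)" if "1 \<le> i" "i \<le> n" for i
    unfolding H_comb_eq_toral[OF n2] using that by (intro L_toral) auto
  have "(L n i (H_comb n c) + L n j (H_comb n c)) / \<i> \<ge> 0 \<and> (L n i (H_comb n c) - L n j (H_comb n c)) / \<i> \<ge> 0"
    if ij: "1 \<le> i" "i < j" "j \<le> n" for i j
  proof -
    have "0 \<le> E_coord n c i + E_coord n c j" "0 \<le> E_coord n c i - E_coord n c j"
      using E_coord_add_nonneg[OF n c ij] E_coord_antimono[OF n c, of i j] ij by auto
    then show ?thesis
      using ij by (simp add: L add_divide_distrib diff_divide_distrib less_eq_complex_def)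
  qed
  then show ?thesis unfolding dominant_lattice_def pos_roots_def using lat by blast
qed

text \<open>
The element \<open>\<xi>_I + \<Sum> d_i H_i\<close>.  As the coefficients of integral elements are integers, the
elements of the cone that are integral have coefficients at least 1 on \<open>I\<close>, and \<open>d\<close> is their excess.
\<close>

definition xi_plus :: "nat \<Rightarrow> nat set \<Rightarrow> (nat \<Rightarrow> nat) \<Rightarrow> real mat" where
  "xi_plus n I d = H_comb n (\<lambda>i. real (of_bool (i \<in> I) + d i))"

definition weighted_excess :: "nat \<Rightarrow> nat set \<Rightarrow> (nat \<Rightarrow> nat) \<Rightarrow> nat" where
  "weighted_excess n I d = (\<Sum>i\<in>I0 n I. i * d i)"

definition admissible :: "nat \<Rightarrow> nat set \<Rightarrow> (nat \<Rightarrow> nat) \<Rightarrow> bool" where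
  "admissible n I d \<longleftrightarrow> (\<forall>i. i \<notin> I \<longrightarrow> d i = 0) \<and>
     spin_cond n ((\<Sum>i\<in>I0 n I. i) + weighted_excess n I d)
       (of_bool (n - 1 \<in> I) + d (n - 1)) (of_bool (n \<in> I) + d n)"

lemma xi_plus_in_integral_lattice_iff:
  assumes "n \<ge> 3" "\<forall>i. i \<notin> I \<longrightarrow> d i = 0"
  shows "xi_plus n I d \<in> integral_lattice n \<longleftrightarrow> admissible n I d"
proof -
  have "(\<Sum>i=1..n-2. i * (of_bool (i \<in> I) + d i)) = (\<Sum>i\<in>I0 n I. i * (1 + d i))"
    using assms(2) by (intro sum.mono_neutral_cong_right) (auto simp: I0_def)
  then show ?thesis
    using assms(2) unfolding xi_plus_def H_comb_nat_in_integral_lattice_iff[OF assms(1)]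
    by (simp add: admissible_def weighted_excess_def distrib_left sum.distrib)
qed

text \<open>
Dominance is automatic on the cone, and integrality forces integer coefficients.
\<close>

lemma dominant_cone_eq:
  assumes n: "n \<ge> 3" and I: "I \<subseteq> {1..n}"
  shows "dominant_lattice n \<inter> cone n I = xi_plus n I ` Collect (admissible n I)"
proof (intro equalityI subsetI)
  fix \<xi> assume "\<xi> \<in> dominant_lattice n \<inter> cone n I"
  then obtain c where lat: "\<xi> \<in> integral_lattice n" and \<xi>: "\<xi> = H_comb n c"
    and c: "\<forall>i\<in>{1..n}. c i \<ge> 0 \<and> (c i = 0 \<longleftrightarrow> i \<notin> I)"
    unfolding dominant_lattice_def cone_def H_comb_def by blast
  have n2: "n \<ge> 2" using n by simp
  have int: "c i \<in> \<int>" if "i \<in> {1..n}" for i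
    using that lat unfolding \<xi> H_comb_eq_toral[OF n2] toral_in_integral_lattice_iff
    by (blast intro: coeff_Ints[OF n])
  define d where "d i = (if i \<in> I then nat \<lfloor>c i\<rfloor> - 1 else 0)" for i
  have d: "real (of_bool (i \<in> I) + d i) = c i" if i: "i \<in> {1..n}" for i
  proof (cases "i \<in> I")
    case True
    obtain z where z: "c i = of_int z" using int[OF i] by (auto elim: Ints_cases)
    have "c i > 0" using c i True by force
    then have "z \<ge> 1" using z by simp
    then show ?thesis using True z by (simp add: d_def)
  next
    case False
    then show ?thesis using c i by (simp add: d_def)
  qed
  have "xi_plus n I d = \<xi>"
    unfolding xi_plus_def \<xi> H_comb_def sum_matrices_def
    by (intro cong_mat refl) (auto simp: d carrier_matD[OF H_carrier] simp del: of_nat_add intro!: sum.cong)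
  moreover have "\<forall>i. i \<notin> I \<longrightarrow> d i = 0" by (simp add: d_def)
  ultimately have "admissible n I d" using lat xi_plus_in_integral_lattice_iff[OF n, of I d] by simp
  then show "\<xi> \<in> xi_plus n I ` Collect (admissible n I)" using \<open>xi_plus n I d = \<xi>\<close> by blast
next
  fix \<xi> assume "\<xi> \<in> xi_plus n I ` Collect (admissible n I)"
  then obtain d where d: "admissible n I d" "\<xi> = xi_plus n I d" by blast
  have supp: "\<forall>i. i \<notin> I \<longrightarrow> d i = 0" using d(1) by (simp add: admissible_def)
  have "\<xi> \<in> integral_lattice n" using d xi_plus_in_integral_lattice_iff[OF n supp] by simp
  then have "\<xi> \<in> dominant_lattice n"
    unfolding d(2) xi_plus_def by (intro H_comb_in_dominant_lattice[OF n]) auto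
  moreover have "\<xi> \<in> cone n I"
    unfolding cone_def d(2) xi_plus_def H_comb_def using supp by fastforce
  ultimately show "\<xi> \<in> dominant_lattice n \<inter> cone n I" by blast
qed

lemma canonical_le_xi_plus_iff:
  assumes n: "n \<ge> 3" and I: "I \<subseteq> {1..n}" and adm: "admissible n I d" "admissible n I d'"
  shows "canonical_le n (xi_plus n I d) (xi_plus n I d') \<longleftrightarrow> d' \<le> d"
proof -
  have n2: "n \<ge> 2" using n by simp
  have int: "\<forall>i\<in>{1..n}. E_coord n (\<lambda>i. real (of_bool (i \<in> I) + e i)) i \<in> \<int>"
    if "admissible n I e" for e
  proof -
    have "xi_plus n I e \<in> integral_lattice n"
      using that xi_plus_in_integral_lattice_iff[OF n, of I e] by (simp add: admissible_def)
    then show ?thesis unfolding xi_plus_def H_comb_eq_toral[OF n2] toral_in_integral_lattice_iff by blast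
  qed
  have "canonical_le n (xi_plus n I d) (xi_plus n I d') \<longleftrightarrow> (\<forall>i\<in>{1..n}. d' i \<le> d i)"
    unfolding xi_plus_def by (subst canonical_le_H_comb_iff[OF n int[OF adm(1)] int[OF adm(2)]]) auto
  moreover have "d' i = 0" if "i \<notin> {1..n}" for i
    using that adm(2) I by (auto simp: admissible_def)
  ultimately show ?thesis by (metis le0 le_fun_def)
qed

text \<open>
The order of elements reverses the order of excess vectors.  A set of solutions that lies below
every solution and is an antichain consists of exactly the minimal solutions.
\<close>

lemma canonical_elements_eqI:
  assumes n: "n \<ge> 3" and I: "I \<subseteq> {1..n}"
    and M: "\<And>m. m \<in> M \<Longrightarrow> admissible n I m"
    and dom: "\<And>d. admissible n I d \<Longrightarrow> \<exists>m\<in>M. m \<le> d"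
    and anti: "\<And>m m'. m \<in> M \<Longrightarrow> m' \<in> M \<Longrightarrow> m \<le> m' \<Longrightarrow> m = m'"
  shows "canonical_elements n I = xi_plus n I ` M"
proof (intro equalityI subsetI)
  fix \<xi> assume "\<xi> \<in> canonical_elements n I"
  then obtain d where d: "admissible n I d" "\<xi> = xi_plus n I d"
    and max: "\<And>d'. admissible n I d' \<Longrightarrow> canonical_le n \<xi> (xi_plus n I d') \<Longrightarrow> xi_plus n I d' = \<xi>"
    unfolding canonical_elements_def dominant_cone_eq[OF n I] by blast
  obtain m where m: "m \<in> M" "m \<le> d" using dom d(1) by blast
  then have "xi_plus n I m = \<xi>"
    using max M canonical_le_xi_plus_iff[OF n I d(1)] d(2) by blast
  then show "\<xi> \<in> xi_plus n I ` M" using m(1) by blast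
next
  fix \<xi> assume "\<xi> \<in> xi_plus n I ` M"
  then obtain m where m: "m \<in> M" "\<xi> = xi_plus n I m" by blast
  have "d = m" if d: "admissible n I d" "canonical_le n \<xi> (xi_plus n I d)" for d
  proof -
    have "d \<le> m" using d m M canonical_le_xi_plus_iff[OF n I] by blast
    moreover obtain m' where "m' \<in> M" "m' \<le> d" using dom[OF d(1)] by blast
    ultimately show ?thesis using anti m(1) by (metis order.antisym order.trans)
  qed
  then show "\<xi> \<in> canonical_elements n I"
    unfolding canonical_elements_def dominant_cone_eq[OF n I] using m M by blast
qed

definition single :: "nat \<Rightarrow> nat \<Rightarrow> nat \<Rightarrow> nat" where
  "single s k i = (if i = s then k else 0)"

lemma single_le_iff: "single s k \<le> d \<longleftrightarrow> k \<le> d s"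
  by (auto simp: le_fun_def single_def)

lemma single_add_le_iff:
  "s \<noteq> t \<Longrightarrow> (\<lambda>i. single s k i + single t l i) \<le> d \<longleftrightarrow> k \<le> d s \<and> l \<le> d t"
  by (auto simp: le_fun_def single_def)

lemma finite_I0 [simp]: "finite (I0 n I)"
  by (simp add: I0_def)

lemma weighted_excess_zero [simp]: "weighted_excess n I (\<lambda>_. 0) = 0"
  by (simp add: weighted_excess_def)

lemma weighted_excess_single: "weighted_excess n I (single s k) = (if s \<in> I0 n I then s * k else 0)"
  by (simp add: weighted_excess_def single_def if_distrib[of "\<lambda>x. _ * x"] cong: if_cong)

lemma weighted_excess_add: "weighted_excess n I (\<lambda>i. d i + e i) = weighted_excess n I d + weighted_excess n I e"
  by (simp add: weighted_excess_def distrib_left sum.distrib)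

lemma odd_weighted_excessD:
  assumes "odd (weighted_excess n I d)"
  shows "\<exists>j\<in>I0 n I. odd j \<and> 1 \<le> d j"
proof (rule ccontr)
  assume "\<not> ?thesis"
  then have "even (j * d j)" if "j \<in> I0 n I" for j
    using that by (cases "d j") auto
  then show False using assms by (auto simp: weighted_excess_def intro: dvd_sum)
qed

lemma xi_plus_carrier [simp, intro]: "xi_plus n I d \<in> carrier_mat (2 * n) (2 * n)"
  by (simp add: xi_plus_def)

lemma xi_eq_xi_plus:
  assumes "I \<subseteq> {1..n}"
  shows "xi n I = xi_plus n I (\<lambda>_. 0)"
proof (rule eq_matI)
  fix r c assume "r < dim_row (xi_plus n I (\<lambda>_. 0))" "c < dim_col (xi_plus n I (\<lambda>_. 0))"
  then have rc: "r < 2 * n" "c < 2 * n" by (auto simp: carrier_matD[OF xi_plus_carrier])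
  have "(\<Sum>i\<in>I. H n i $$ (r, c)) = (\<Sum>i=1..n. of_bool (i \<in> I) * H n i $$ (r, c))"
    using assms by (intro sum.mono_neutral_cong_left) auto
  then show "xi n I $$ (r, c) = xi_plus n I (\<lambda>_. 0) $$ (r, c)"
    using rc unfolding xi_plus_def H_comb_entry[OF rc] by (simp add: xi_def sum_matrices_def)
qed (auto simp: xi_def sum_matrices_def carrier_matD[OF xi_plus_carrier])

lemma xi_plus_add_H:
  assumes "s \<in> {1..n}"
  shows "xi_plus n I d + real k \<cdot>\<^sub>m H n s = xi_plus n I (\<lambda>i. d i + single s k i)"
proof (rule eq_matI)
  fix r c assume "r < dim_row (xi_plus n I (\<lambda>i. d i + single s k i))"
    "c < dim_col (xi_plus n I (\<lambda>i. d i + single s k i))"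
  then have rc: "r < 2 * n" "c < 2 * n" by (auto simp: carrier_matD[OF xi_plus_carrier])
  have "(\<Sum>i=1..n. real (single s k i) * H n i $$ (r, c))
    = (\<Sum>i=1..n. if i = s then real k * H n s $$ (r, c) else 0)"
    by (intro sum.cong) (auto simp: single_def)
  then have "(\<Sum>i=1..n. real (single s k i) * H n i $$ (r, c)) = real k * H n s $$ (r, c)"
    using assms by simp
  then show "(xi_plus n I d + real k \<cdot>\<^sub>m H n s) $$ (r, c) = xi_plus n I (\<lambda>i. d i + single s k i) $$ (r, c)"
    using rc unfolding xi_plus_def
    by (simp add: H_comb_entry carrier_matD[OF H_carrier] carrier_matD[OF H_comb_carrier] distrib_right sum.distrib)
qed (auto simp: carrier_matD[OF xi_plus_carrier] carrier_matD[OF H_carrier])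

lemma add_zero_smult:
  assumes "X \<in> carrier_mat m m" "M \<in> carrier_mat m m"
  shows "X + 0 \<cdot>\<^sub>m M = (X :: real mat)"
  using assms by (intro eq_matI) auto

lemma xi_carrier: "xi n I \<in> carrier_mat (2 * n) (2 * n)"
  by (simp add: xi_def)


lemma xi_add_H:
  assumes "I \<subseteq> {1..n}" "s \<in> {1..n}"
  shows "xi n I + real k \<cdot>\<^sub>m H n s = xi_plus n I (single s k)"
  using xi_plus_add_H[OF assms(2), of I "\<lambda>_. 0" k] by (simp add: xi_eq_xi_plus[OF assms(1)])

lemma xi_add_two_H:
  assumes "I \<subseteq> {1..n}" "s \<in> {1..n}" "t \<in> {1..n}"
  shows "xi n I + 1 \<cdot>\<^sub>m (H n s + H n t) = xi_plus n I (\<lambda>i. single s 1 i + single t 1 i)"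
proof -
  have "xi n I + 1 \<cdot>\<^sub>m (H n s + H n t) = xi n I + real 1 \<cdot>\<^sub>m H n s + real 1 \<cdot>\<^sub>m H n t"
    by (rule eq_matI) (auto simp: carrier_matD[OF xi_carrier] carrier_matD[OF H_carrier])
  then show ?thesis by (simp only: xi_add_H[OF assms(1,2)] xi_plus_add_H[OF assms(3)])
qed

section \<open>Minimal solutions of the congruence\<close>

definition supported :: "nat set \<Rightarrow> (nat \<Rightarrow> nat) \<Rightarrow> bool" where
  "supported I d \<longleftrightarrow> (\<forall>i. i \<notin> I \<longrightarrow> d i = 0)"

lemma supported_single: "s \<in> I \<Longrightarrow> supported I (single s k)"
  by (auto simp: supported_def single_def)

lemma supported_add: "supported I d \<Longrightarrow> supported I e \<Longrightarrow> supported I (\<lambda>i. d i + e i)"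
  by (simp add: supported_def)

lemma single_inj_le: "single s 1 \<le> single t 1 \<Longrightarrow> s = t"
  by (auto simp: single_le_iff single_def split: if_splits)

context
  fixes n :: nat and I :: "nat set"
  assumes n: "n \<ge> 3" and I: "I \<subseteq> {1..n}"
begin

lemma I0_D: "j \<in> I0 n I \<Longrightarrow> j \<in> I \<and> 1 \<le> j \<and> j \<le> n \<and> j \<noteq> n - 1 \<and> j \<noteq> n"
  using n by (auto simp: I0_def)

lemma last_two_notin_I0 [simp]: "n \<notin> I0 n I" "n - 1 \<notin> I0 n I" "n - Suc 0 \<notin> I0 n I"
  using n by (auto simp: I0_def)

lemma admissible_none:
  assumes "n - 1 \<notin> I" "n \<notin> I"
  shows "admissible n I d \<longleftrightarrow> supported I d \<and> even ((\<Sum>i\<in>I0 n I. i) + weighted_excess n I d)"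
proof -
  define S where "S = (\<Sum>i\<in>I0 n I. i) + weighted_excess n I d"
  have "4 dvd 2 * int S \<longleftrightarrow> even S" by presburger
  then show ?thesis
    using assms by (auto simp: admissible_def supported_def spin_cond_def simp flip: S_def)
qed

text \<open>
Both choices of \<open>s\<close> give the same condition: for odd \<open>n\<close> the coefficient of \<open>H_s\<close> enters with a sign
that depends on \<open>s\<close>, but \<open>2 S - x\<close> and \<open>2 S + x\<close> are divisible by 4 simultaneously, since either
forces \<open>x\<close> to be even.
\<close>

lemma admissible_one:
  assumes "I \<inter> {n - 1, n} = {s}"
  shows "admissible n I d \<longleftrightarrow> supported I d \<and>
    (if odd n then 4 dvd 2 * ((\<Sum>i\<in>I0 n I. i) + weighted_excess n I d) + 1 + d s
     else odd (d s) \<and> even ((\<Sum>i\<in>I0 n I. i) + weighted_excess n I d))"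
proof (cases "supported I d")
  case True
  define S where "S = (\<Sum>i\<in>I0 n I. i) + weighted_excess n I d"
  have adm: "admissible n I d \<longleftrightarrow> spin_cond n S (of_bool (n - 1 \<in> I) + d (n - 1)) (of_bool (n \<in> I) + d n)"
    using True by (simp add: admissible_def supported_def S_def)
  have "x \<in> I \<and> (x = n - 1 \<or> x = n) \<longleftrightarrow> x = s" for x using assms by blast
  moreover have "n - 1 \<noteq> n" using n by simp
  ultimately consider "s = n - 1" "n \<notin> I" "n - 1 \<in> I" | "s = n" "n - 1 \<notin> I" "n \<in> I" by metis
  then show ?thesis
  proof cases
    case 1
    then have "d n = 0" using True by (simp add: supported_def)
    moreover have "4 dvd 2 * int S - (1 + int (d s)) \<longleftrightarrow> 4 dvd 2 * S + 1 + d s" by presburger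
    moreover have "even (Suc (d s)) \<and> even (S + Suc (d s)) \<longleftrightarrow> odd (d s) \<and> even S" by presburger
    ultimately show ?thesis using 1 True unfolding adm by (simp add: spin_cond_def flip: S_def)
  next
    case 2
    then have "d (n - 1) = 0" using True by (simp add: supported_def)
    moreover have "4 dvd 2 * int S + (1 + int (d s)) \<longleftrightarrow> 4 dvd 2 * S + 1 + d s" by presburger
    ultimately show ?thesis using 2 True unfolding adm by (simp add: spin_cond_def flip: S_def)
  qed
next
  case False
  then have "\<not> admissible n I d" unfolding admissible_def supported_def by blast
  then show ?thesis using False by simp
qed

lemma admissible_both:
  assumes "n - 1 \<in> I" "n \<in> I"
  shows "admissible n I d \<longleftrightarrow> supported I d \<and>
    (if odd n then 4 dvd 2 * int ((\<Sum>i\<in>I0 n I. i) + weighted_excess n I d) + int (d n) - int (d (n - 1))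
     else even (d (n - 1) + d n) \<and> odd ((\<Sum>i\<in>I0 n I. i) + weighted_excess n I d + d (n - 1)))"
proof -
  define S where "S = (\<Sum>i\<in>I0 n I. i) + weighted_excess n I d"
  have "spin_cond n S (1 + d (n - 1)) (1 + d n) \<longleftrightarrow>
     (if odd n then 4 dvd 2 * int S + int (d n) - int (d (n - 1))
      else even (d (n - 1) + d n) \<and> odd (S + d (n - 1)))"
    by (simp add: spin_cond_def algebra_simps)
  then show ?thesis using assms by (simp add: admissible_def supported_def flip: S_def)
qed

lemma canonical_zero:
  assumes "admissible n I (\<lambda>_. 0)"
  shows "canonical_elements n I = {xi n I}"
  using canonical_elements_eqI[OF n I, of "{\<lambda>_. 0}"] assms by (simp add: xi_eq_xi_plus[OF I] le_fun_def)

text \<open>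
An odd weighted excess needs an odd index with a positive excess.
\<close>

lemma canonical_odd_H:
  assumes "\<And>d. admissible n I d \<longleftrightarrow> supported I d \<and> odd (weighted_excess n I d)"
  shows "canonical_elements n I = {xi n I + 1 \<cdot>\<^sub>m H n j | j. j \<in> I0 n I \<and> odd j}"
proof -
  have "canonical_elements n I = xi_plus n I ` (\<lambda>j. single j 1) ` {j. j \<in> I0 n I \<and> odd j}"
  proof (rule canonical_elements_eqI[OF n I])
    show "admissible n I m" if "m \<in> (\<lambda>j. single j 1) ` {j. j \<in> I0 n I \<and> odd j}" for m
      using that I0_D unfolding assms by (auto simp: supported_single weighted_excess_single)
    show "\<exists>m\<in>(\<lambda>j. single j 1) ` {j. j \<in> I0 n I \<and> odd j}. m \<le> d" if "admissible n I d" for d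
      using that odd_weighted_excessD unfolding assms by (force simp: single_le_iff)
  qed (use single_inj_le in blast)
  also have "\<dots> = {xi n I + 1 \<cdot>\<^sub>m H n j | j. j \<in> I0 n I \<and> odd j}"
    unfolding image_image setcompr_eq_image using I0_D xi_add_H[OF I, of _ 1] by (intro image_cong) auto
  finally show ?thesis .
qed

lemma canonical_single_last:
  assumes s: "I \<inter> {n - 1, n} = {s}" and m: "admissible n I (single s 1)"
  shows "canonical_elements n I = {xi n I + 1 \<cdot>\<^sub>m H n s}"
proof -
  have "canonical_elements n I = xi_plus n I ` {single s 1}"
  proof (rule canonical_elements_eqI[OF n I])
    show "\<exists>m\<in>{single s 1}. m \<le> d" if "admissible n I d" for d
    proof -
      have "odd (d s)" using that unfolding admissible_one[OF s] by (auto split: if_splits) presburger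
      then show ?thesis by (simp add: single_le_iff odd_pos Suc_leI)
    qed
  qed (use m in auto)
  then show ?thesis using xi_add_H[OF I, of s 1] s I by auto
qed

text \<open>
With \<open>q\<close> the weighted excess, 4 has to divide \<open>2 q + 1 + d_s\<close>, so \<open>d_s\<close> is odd: either it is at least 3,
or it is 1 and \<open>q\<close> is odd.
\<close>

lemma canonical_odd_even_one:
  assumes odd: "odd n" and even: "even (\<Sum>i\<in>I0 n I. i)" and s: "I \<inter> {n - 1, n} = {s}"
  shows "canonical_elements n I = {xi n I + 3 \<cdot>\<^sub>m H n s}
    \<union> {xi n I + 1 \<cdot>\<^sub>m (H n s + H n j) | j. j \<in> I0 n I \<and> odd j}"
proof -
  have sI: "s \<in> I" "s \<in> {1..n}" "s \<notin> I0 n I" using s I n by (auto simp: I0_def)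
  have adm: "admissible n I d \<longleftrightarrow> supported I d \<and> 4 dvd 2 * weighted_excess n I d + 1 + d s" for d
  proof -
    obtain q where q: "(\<Sum>i\<in>I0 n I. i) = 2 * q" using even by blast
    have "4 dvd 2 * (2 * q + D) + 1 + x \<longleftrightarrow> 4 dvd 2 * D + 1 + x" for D x by presburger
    then show ?thesis unfolding admissible_one[OF s] q using odd by simp
  qed
  let ?two = "\<lambda>j i. single s 1 i + single j 1 i"
  let ?M = "{single s 3} \<union> ?two ` {j. j \<in> I0 n I \<and> odd j}"
  have ne: "s \<noteq> j" if "j \<in> I0 n I" for j using that sI by blast
  have "canonical_elements n I = xi_plus n I ` ?M"
  proof (rule canonical_elements_eqI[OF n I])
    show "admissible n I m" if "m \<in> ?M" for m
    proof -
      have "4 dvd 2 * j + 2" if "odd j" for j :: nat using that by presburger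
      then show ?thesis
        using that ne I0_D sI unfolding adm
        by (auto simp: supported_single supported_add weighted_excess_single weighted_excess_add)
          (auto simp: single_def)
    qed
    show "\<exists>m\<in>?M. m \<le> d" if "admissible n I d" for d
    proof (cases "3 \<le> d s")
      case True
      then show ?thesis by (simp add: single_le_iff)
    next
      case False
      have "x = 1 \<and> odd D" if "4 dvd 2 * D + 1 + x" "\<not> 3 \<le> x" for x D :: nat
        using that by presburger
      moreover have "4 dvd 2 * weighted_excess n I d + 1 + d s" using that by (simp add: adm)
      ultimately have "d s = 1" "odd (weighted_excess n I d)" using False by blast+
      then obtain j where "j \<in> I0 n I" "odd j" "1 \<le> d j" using odd_weighted_excessD by blast
      then have "?two j \<le> d" "?two j \<in> ?M" using \<open>d s = 1\<close> ne by (auto simp: single_add_le_iff)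
      then show ?thesis by blast
    qed
    show "m = m'" if "m \<in> ?M" "m' \<in> ?M" "m \<le> m'" for m m'
      using that ne by (auto simp: single_add_le_iff single_le_iff) (auto simp: single_def split: if_splits)
  qed
  also have "\<dots> = {xi n I + 3 \<cdot>\<^sub>m H n s}
    \<union> {xi n I + 1 \<cdot>\<^sub>m (H n s + H n j) | j. j \<in> I0 n I \<and> odd j}"
    unfolding image_Un image_image setcompr_eq_image
    using I0_D xi_add_H[OF I sI(2), of 3] xi_add_two_H[OF I sI(2)]
    by (intro arg_cong2[of _ _ _ _ "(\<union>)"] image_cong) auto
  finally show ?thesis .
qed

text \<open>
With \<open>q\<close> the weighted excess, 4 has to divide \<open>2 q + 2 + d_n - d_(n-1)\<close>: either \<open>q\<close> is odd, or \<open>d_n\<close>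
and \<open>d_(n-1)\<close> differ by 2 modulo 4, so one of them is at least 2.
\<close>

lemma canonical_odd_odd_both:
  assumes odd: "odd n" and odd': "odd (\<Sum>i\<in>I0 n I. i)" and s: "n - 1 \<in> I" "n \<in> I"
  shows "canonical_elements n I = {xi n I + 2 \<cdot>\<^sub>m H n s | s. s \<in> {n - 1, n}}
    \<union> {xi n I + 1 \<cdot>\<^sub>m H n j | j. j \<in> I0 n I \<and> odd j}"
proof -
  have adm: "admissible n I d \<longleftrightarrow> supported I d \<and>
      4 dvd 2 * int (weighted_excess n I d) + 2 + int (d n) - int (d (n - 1))" for d
  proof -
    obtain q where q: "(\<Sum>i\<in>I0 n I. i) = 2 * q + 1" using odd' by (auto elim: oddE)
    have eq: "4 dvd 2 * int (2 * q + 1 + D) + y - x \<longleftrightarrow> 4 dvd 2 * int D + 2 + y - x" for D x y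
      by presburger
    show ?thesis unfolding admissible_both[OF s] q eq using odd by simp
  qed
  let ?M = "(\<lambda>s. single s 2) ` {s. s \<in> {n - 1, n}} \<union> (\<lambda>j. single j 1) ` {j. j \<in> I0 n I \<and> odd j}"
  have "canonical_elements n I = xi_plus n I ` ?M"
  proof (rule canonical_elements_eqI[OF n I])
    show "admissible n I m" if "m \<in> ?M" for m
    proof -
      have "4 dvd 2 * int j + 2" if "odd j" for j :: nat using that by presburger
      then show ?thesis
        using that I0_D s n unfolding adm
        by (auto simp: supported_single weighted_excess_single) (auto simp: single_def)
    qed
    show "\<exists>m\<in>?M. m \<le> d" if "admissible n I d" for d
    proof (cases "odd (weighted_excess n I d)")
      case True
      then obtain j where j: "j \<in> I0 n I" "odd j" "1 \<le> d j" using odd_weighted_excessD by blast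
      then have "single j 1 \<in> ?M" "single j 1 \<le> d" by (auto simp: single_le_iff)
      then show ?thesis by blast
    next
      case False
      have "2 \<le> y \<or> 2 \<le> x" if "4 dvd 2 * int D + 2 + int y - int x" "even D" for D x y :: nat
        using that by presburger
      moreover have "4 dvd 2 * int (weighted_excess n I d) + 2 + int (d n) - int (d (n - 1))"
        using that by (simp add: adm)
      ultimately have "2 \<le> d n \<or> 2 \<le> d (n - 1)" using False by blast
      then have "single n 2 \<le> d \<or> single (n - 1) 2 \<le> d" by (simp only: single_le_iff)
      then show ?thesis by blast
    qed
    show "m = m'" if "m \<in> ?M" "m' \<in> ?M" "m \<le> m'" for m m'
      using that by (auto simp: single_le_iff) (auto simp: single_def split: if_splits)
  qed
  also have "\<dots> = {xi n I + 2 \<cdot>\<^sub>m H n s | s. s \<in> {n - 1, n}}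
    \<union> {xi n I + 1 \<cdot>\<^sub>m H n j | j. j \<in> I0 n I \<and> odd j}"
    unfolding image_Un image_image setcompr_eq_image
    using I0_D xi_add_H[OF I, of _ 1] xi_add_H[OF I, of _ 2] n
    by (intro arg_cong2[of _ _ _ _ "(\<union>)"] image_cong) auto
  finally show ?thesis .
qed

text \<open>
The excesses \<open>d_(n-1)\<close> and \<open>d_n\<close> have the same parity, which is opposite to that of the weighted excess.
\<close>

lemma canonical_even_even_both:
  assumes even: "even n" and even': "even (\<Sum>i\<in>I0 n I. i)" and s: "n - 1 \<in> I" "n \<in> I"
  shows "canonical_elements n I = {xi n I + 1 \<cdot>\<^sub>m H n j | j. j \<in> I0 n I \<and> odd j}
    \<union> {xi n I + 1 \<cdot>\<^sub>m (H n (n - 1) + H n n)}"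
proof -
  have adm: "admissible n I d \<longleftrightarrow> supported I d \<and> even (d (n - 1) + d n) \<and> odd (weighted_excess n I d + d (n - 1))" for d
    unfolding admissible_both[OF s] using even even' by simp
  let ?two = "\<lambda>i. single (n - 1) 1 i + single n 1 i"
  let ?M = "(\<lambda>j. single j 1) ` {j. j \<in> I0 n I \<and> odd j} \<union> {?two}"
  have ne: "n - 1 \<noteq> n" using n by simp
  have "canonical_elements n I = xi_plus n I ` ?M"
  proof (rule canonical_elements_eqI[OF n I])
    show "admissible n I m" if "m \<in> ?M" for m
      using that I0_D s ne unfolding adm
      by (auto simp: supported_single supported_add weighted_excess_single weighted_excess_add)
        (auto simp: single_def split: if_splits)
    show "\<exists>m\<in>?M. m \<le> d" if "admissible n I d" for d
    proof (cases "odd (weighted_excess n I d)")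
      case True
      then obtain j where j: "j \<in> I0 n I" "odd j" "1 \<le> d j" using odd_weighted_excessD by blast
      then have "single j 1 \<in> ?M" "single j 1 \<le> d" by (auto simp: single_le_iff)
      then show ?thesis by blast
    next
      case False
      then have "odd (d (n - 1))" "odd (d n)" using that by (auto simp: adm)
      then have "?two \<le> d" unfolding single_add_le_iff[OF ne] by (simp add: odd_pos Suc_leI)
      then show ?thesis by blast
    qed
    show "m = m'" if "m \<in> ?M" "m' \<in> ?M" "m \<le> m'" for m m'
      using that ne I0_D by (auto simp: single_add_le_iff single_le_iff) (auto simp: single_def split: if_splits)
  qed
  also have "\<dots> = {xi n I + 1 \<cdot>\<^sub>m H n j | j. j \<in> I0 n I \<and> odd j}
    \<union> {xi n I + 1 \<cdot>\<^sub>m (H n (n - 1) + H n n)}"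
    unfolding image_Un image_image setcompr_eq_image
    using I0_D xi_add_H[OF I, of _ 1] xi_add_two_H[OF I, of "n - 1" n] n
    by (intro arg_cong2[of _ _ _ _ "(\<union>)"] image_cong) auto
  finally show ?thesis .
qed

lemma canonical_even_odd_one:
  assumes even: "even n" and odd: "odd (\<Sum>i\<in>I0 n I. i)" and s: "I \<inter> {n - 1, n} = {s}"
  shows "canonical_elements n I = {xi n I + 1 \<cdot>\<^sub>m (H n s + H n j) | j. j \<in> I0 n I \<and> odd j}"
proof -
  have sI: "s \<in> I" "s \<in> {1..n}" "s \<notin> I0 n I" using s I n by (auto simp: I0_def)
  have adm: "admissible n I d \<longleftrightarrow> supported I d \<and> odd (d s) \<and> odd (weighted_excess n I d)" for d
    unfolding admissible_one[OF s] using even odd by simp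
  let ?two = "\<lambda>j i. single s 1 i + single j 1 i"
  let ?M = "?two ` {j. j \<in> I0 n I \<and> odd j}"
  have ne: "s \<noteq> j" if "j \<in> I0 n I" for j using that sI by blast
  have "canonical_elements n I = xi_plus n I ` ?M"
  proof (rule canonical_elements_eqI[OF n I])
    show "admissible n I m" if "m \<in> ?M" for m
      using that ne I0_D sI unfolding adm
      by (auto simp: supported_single supported_add weighted_excess_single weighted_excess_add) (auto simp: single_def)
    show "\<exists>m\<in>?M. m \<le> d" if "admissible n I d" for d
    proof -
      have "odd (d s)" "odd (weighted_excess n I d)" using that by (auto simp: adm)
      moreover obtain j where "j \<in> I0 n I" "odd j" "1 \<le> d j" using odd_weighted_excessD calculation(2) by blast
      ultimately have "?two j \<le> d" "?two j \<in> ?M"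
        using ne by (auto simp: single_add_le_iff odd_pos Suc_leI)
      then show ?thesis by blast
    qed
    show "m = m'" if "m \<in> ?M" "m' \<in> ?M" "m \<le> m'" for m m'
      using that ne by (auto simp: single_add_le_iff) (auto simp: single_def split: if_splits)
  qed
  also have "\<dots> = {xi n I + 1 \<cdot>\<^sub>m (H n s + H n j) | j. j \<in> I0 n I \<and> odd j}"
    unfolding image_image setcompr_eq_image
    using I0_D xi_add_two_H[OF I sI(2)] by (intro image_cong) auto
  finally show ?thesis .
qed

end


theorem theorem6p9:
  fixes n :: nat and I :: "nat set"
  assumes "n \<ge> 3" and "I \<subseteq> {1..n}"
  shows
    "(odd n \<and> even (\<Sum>i\<in>I0 n I. i) \<longrightarrow>
        canonical_elements n I =
          {xi n I + (3 * eps n I 1) \<cdot>\<^sub>m H n s | s.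
             eps n I 1 \<noteq> 0 \<longrightarrow> s \<in> I \<inter> {n - 1, n}}
        \<union> {xi n I + eps n I 1 \<cdot>\<^sub>m (H n s + H n j) | s j.
             eps n I 1 \<noteq> 0 \<longrightarrow> s \<in> I \<inter> {n - 1, n} \<and> j \<in> I0 n I \<and> odd j}) \<and>
     (odd n \<and> odd (\<Sum>i\<in>I0 n I. i) \<longrightarrow>
        canonical_elements n I =
          {xi n I + eps n I 0 \<cdot>\<^sub>m H n j + eps n I 1 \<cdot>\<^sub>m H n s + (2 * eps n I 2) \<cdot>\<^sub>m H n s | s j.
             (eps n I 0 \<noteq> 0 \<longrightarrow> j \<in> I0 n I \<and> odd j) \<and>
             (eps n I 1 \<noteq> 0 \<or> eps n I 2 \<noteq> 0 \<longrightarrow> s \<in> I \<inter> {n - 1, n})}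
        \<union> {xi n I + eps n I 0 \<cdot>\<^sub>m H n j + eps n I 1 \<cdot>\<^sub>m H n s + eps n I 2 \<cdot>\<^sub>m H n j | s j.
             (eps n I 0 \<noteq> 0 \<or> eps n I 2 \<noteq> 0 \<longrightarrow> j \<in> I0 n I \<and> odd j) \<and>
             (eps n I 1 \<noteq> 0 \<longrightarrow> s \<in> I \<inter> {n - 1, n})}) \<and>
     (even n \<and> even (\<Sum>i\<in>I0 n I. i) \<longrightarrow>
        canonical_elements n I =
          {xi n I + eps n I 1 \<cdot>\<^sub>m H n s + eps n I 2 \<cdot>\<^sub>m H n j | s j.
             (eps n I 1 \<noteq> 0 \<longrightarrow> s \<in> I \<inter> {n - 1, n}) \<and>
             (eps n I 2 \<noteq> 0 \<longrightarrow> j \<in> I0 n I \<and> odd j)}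
        \<union> {xi n I + eps n I 1 \<cdot>\<^sub>m H n s + eps n I 2 \<cdot>\<^sub>m (H n (n - 1) + H n n) | s.
             eps n I 1 \<noteq> 0 \<longrightarrow> s \<in> I \<inter> {n - 1, n}}) \<and>
     (even n \<and> odd (\<Sum>i\<in>I0 n I. i) \<longrightarrow>
        canonical_elements n I =
          {xi n I + eps n I 0 \<cdot>\<^sub>m H n j + eps n I 1 \<cdot>\<^sub>m (H n s + H n j) | s j.
             (eps n I 0 \<noteq> 0 \<or> eps n I 1 \<noteq> 0 \<longrightarrow> j \<in> I0 n I \<and> odd j) \<and>
             (eps n I 1 \<noteq> 0 \<longrightarrow> s \<in> I \<inter> {n - 1, n})})"
  proof -
  note n = assms(1)
  let ?\<sigma> = "\<Sum>i\<in>I0 n I. i"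
  note canonical = canonical_zero[OF assms] canonical_odd_H[OF assms] canonical_single_last[OF assms]
    canonical_odd_even_one[OF assms] canonical_odd_odd_both[OF assms]
    canonical_even_even_both[OF assms] canonical_even_odd_one[OF assms]
  have ne: "n - 1 \<noteq> n" using n by simp
  have z: "xi n I + 0 \<cdot>\<^sub>m H n s = xi n I" "xi n I + 0 \<cdot>\<^sub>m (H n s + H n j) = xi n I"
    "xi n I + k \<cdot>\<^sub>m H n j + 0 \<cdot>\<^sub>m H n s = xi n I + k \<cdot>\<^sub>m H n j"
    "xi n I + k \<cdot>\<^sub>m H n j + 0 \<cdot>\<^sub>m (H n s + H n t) = xi n I + k \<cdot>\<^sub>m H n j" for s j k t
    by (intro add_zero_smult[of _ "2 * n"] add_carrier_mat smult_carrier_mat xi_carrier H_carrier)+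
  have zero: "supported I (\<lambda>_. 0)" by (simp add: supported_def)
  consider (none) "I \<inter> {n - 1, n} = {}" | (one) s where "I \<inter> {n - 1, n} = {s}"
    | (both) "I \<inter> {n - 1, n} = {n - 1, n}" by blast
  then show ?thesis
  proof cases
    case none
    then have last: "n - 1 \<notin> I" "n \<notin> I" by auto
    have e: "eps n I 0 = 1" "eps n I 1 = 0" "eps n I 2 = 0" unfolding eps_def none by simp_all
    note adm = admissible_none[OF assms last]
    show ?thesis
      unfolding e
      using canonical(1,2)
      by (auto simp: z adm zero)
  next
    case (one s)
    have e: "eps n I 0 = 0" "eps n I 1 = 1" "eps n I 2 = 0" unfolding eps_def one by simp_all
    have "s \<in> I" using one by blast
    note adm = admissible_one[OF assms one] and supp = supported_single[OF \<open>s \<in> I\<close>]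
    have sI0: "s \<notin> I0 n I" using one n by (auto simp: I0_def)
    have deg: "weighted_excess n I (single s k) = 0" "single s k s = k" for k
      using sI0 by (simp_all add: weighted_excess_single) (simp add: single_def)
    have single: "canonical_elements n I = {xi n I + 1 \<cdot>\<^sub>m H n s}" if "odd n \<longleftrightarrow> odd ?\<sigma>"
    proof (rule canonical(3)[OF one])
      have "4 dvd 2 * S + 1 + 1 \<longleftrightarrow> odd S" for S :: nat by presburger
      then show "admissible n I (single s 1)" using that supp by (simp add: adm deg)
    qed
    show ?thesis
      unfolding e one
    proof (intro conjI impI, goal_cases)
      case 1
      then show ?case using canonical(4)[OF _ _ one] by (simp add: z)
    next
      case 2
      then show ?case using single by (simp add: z)
    next
      case 3
      then show ?case using single by (simp add: z)
    next
      case 4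
      then show ?case using canonical(7)[OF _ _ one] by (simp add: z)
    qed
  next
    case both
    have e: "eps n I 0 = 0" "eps n I 1 = 0" "eps n I 2 = 1" using ne unfolding eps_def both by simp_all
    have last: "n - 1 \<in> I" "n \<in> I" using both by auto
    have zero: "canonical_elements n I = {xi n I}" if "odd n \<longleftrightarrow> even ?\<sigma>"
    proof (rule canonical(1))
      have "4 dvd 2 * int S \<longleftrightarrow> even S" for S by presburger
      then show "admissible n I (\<lambda>_. 0)"
        using that zero unfolding admissible_both[OF assms last] by (simp del: of_nat_sum)
    qed
    show ?thesis
      unfolding e both
    proof (intro conjI impI, goal_cases)
      case 1
      then show ?case using zero by (simp add: z)
    next
      case 2
      then show ?case using canonical(5)[OF _ _ last] by (simp add: z)
    next
      case 3
      then show ?case using canonical(6)[OF _ _ last] by (simp add: z)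
    next
      case 4
      then show ?case using zero by (simp add: z)
    qed
  qed
qed

end
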